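(* Let $\mathcal C$ be a balanced factorization category. The two underlying functors $\overline{(-)},\overline{(-)}':\mathcal C\to\mathbf{Cat}$ are related by duality: $\overline{(-)}'\cong\overline{(-)}^{\,\mathrm{op}}$, i.e. $\overline{(-)}'$ is naturally isomorphic to the composite of $\overline{(-)}$ with the duality functor $(-)^{\mathrm{op}}:\mathbf{Cat}\to\mathbf{Cat}$.
   Context: A balanced factorization category is a finitely complete category $\mathcal C$ with two (orthogonal) factorization systems $(\mathcal E,\mathcal M)$ and $(\mathcal E',\mathcal M')$ such that $\mathcal M/1=\mathcal M'/1$ (an object $S$ has $S\to 1$ in $\mathcal M$ iff in $\mathcal M'$), and such that the pullback of a map in $\mathcal E$ along a map in $\mathcal M'$ is in $\mathcal E$, and the pullback of a map in $\mathcal E'$ along a map in $\mathcal M$ is in $\mathcal E'$. Factorizations are chosen. A point $x:1\to X$ factors as $1\xrightarrow{e_x}X/x\xrightarrow{\downarrow x}X$ with $e_x\in\mathcal E$, $\downarrow x\in\mathcal M$ (slice), and as $1\xrightarrow{i_x}x\backslash X\xrightarrow{\uparrow x}X$ with $i_x\in\mathcal E'$, $\uparrow x\in\mathcal M'$ (coslice). Left underlying functor: $\overline X$ has the points of $X$ as objects; a morphism $x\to y$ is a map $\alpha:1\to X/y$ with $(\downarrow y)\alpha=x$, equivalently the unique map $\widehat\alpha:X/x\to X/y$ over $X$ with $\widehat\alpha e_x=\alpha$; composition is $\beta\circ\alpha:=\widehat\beta\alpha$, identities are $e_x$ (so $\overline X(x,y)\cong(\mathcal C/X)(X/x,X/y)$).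 For $f:X\to Y$, $e_{f,x}:X/x\to Y/fx$ is the unique map in $\mathcal E$ with $(\downarrow fx)e_{f,x}=f(\downarrow x)$ and $e_{f,x}e_x=e_{fx}$; $\overline f$ sends $x$ to $fx$ and $\alpha:1\to X/y$ to $e_{f,y}\alpha:1\to Y/fy$. The right underlying functor $\overline{(-)}'$ is defined in the same way from $(\mathcal E',\mathcal M')$: a morphism $x\to y$ of $\overline X'$ is a map $1\to y\backslash X$ over the point $x$, equivalently a map $x\backslash X\to y\backslash X$ over $X$; and $\overline f'$ acts by composition with the unique map $i_{f,y}:y\backslash X\to fy\backslash Y$ in $\mathcal E'$ with $(\uparrow fy)i_{f,y}=f(\uparrow y)$ and $i_{f,y}i_y=i_{fy}$. *)

theory Defs
  imports "HOL-Library.FuncSet"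
begin

section \<open>Categories, functors, natural isomorphisms\<close>

text \<open>
  Categories are carried by sets of objects and arrows. The operations are total functions
  whose values outside these carriers (for composition: on non-composable pairs) are
  irrelevant.
\<close>

record ('o, 'a) cat =
  Obj :: "'o set"
  Arr :: "'a set"
  Dom :: "'a \<Rightarrow> 'o"
  Cod :: "'a \<Rightarrow> 'o"
  Ide :: "'o \<Rightarrow> 'a"
  Comp :: "'a \<Rightarrow> 'a \<Rightarrow> 'a"  (infixl "\<cdot>\<index>" 70)

definition Hom :: "('o, 'a) cat \<Rightarrow> 'o \<Rightarrow> 'o \<Rightarrow> 'a set" where
  "Hom C X Y = {f \<in> Arr C. Dom C f = X \<and> Cod C f = Y}"

definition is_category :: "('o, 'a) cat \<Rightarrow> bool" where
  "is_category C \<longleftrightarrow>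
     (\<forall>f \<in> Arr C. Dom C f \<in> Obj C \<and> Cod C f \<in> Obj C) \<and>
     (\<forall>X \<in> Obj C. Ide C X \<in> Hom C X X) \<and>
     (\<forall>X Y Z. \<forall>f \<in> Hom C X Y. \<forall>g \<in> Hom C Y Z. g \<cdot>\<^bsub>C\<^esub> f \<in> Hom C X Z) \<and>
     (\<forall>f \<in> Arr C. f \<cdot>\<^bsub>C\<^esub> Ide C (Dom C f) = f \<and> Ide C (Cod C f) \<cdot>\<^bsub>C\<^esub> f = f) \<and>
     (\<forall>W X Y Z. \<forall>f \<in> Hom C W X. \<forall>g \<in> Hom C X Y. \<forall>h \<in> Hom C Y Z.
        (h \<cdot>\<^bsub>C\<^esub> g) \<cdot>\<^bsub>C\<^esub> f = h \<cdot>\<^bsub>C\<^esub> (g \<cdot>\<^bsub>C\<^esub> f))"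

definition is_iso :: "('o, 'a) cat \<Rightarrow> 'a \<Rightarrow> bool" where
  "is_iso C f \<longleftrightarrow> f \<in> Arr C \<and>
     (\<exists>g \<in> Hom C (Cod C f) (Dom C f).
        g \<cdot>\<^bsub>C\<^esub> f = Ide C (Dom C f) \<and> f \<cdot>\<^bsub>C\<^esub> g = Ide C (Cod C f))"

record ('o, 'a, 'p, 'b) func =
  FObj :: "'o \<Rightarrow> 'p"
  FArr :: "'a \<Rightarrow> 'b"

definition is_functor ::
    "('o, 'a) cat \<Rightarrow> ('p, 'b) cat \<Rightarrow> ('o, 'a, 'p, 'b) func \<Rightarrow> bool" where
  "is_functor A B F \<longleftrightarrow> is_category A \<and> is_category B \<and>
     (\<forall>X \<in> Obj A. FObj F X \<in> Obj B) \<and>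
     (\<forall>f \<in> Arr A. FArr F f \<in> Hom B (FObj F (Dom A f)) (FObj F (Cod A f))) \<and>
     (\<forall>X \<in> Obj A. FArr F (Ide A X) = Ide B (FObj F X)) \<and>
     (\<forall>X Y Z. \<forall>f \<in> Hom A X Y. \<forall>g \<in> Hom A Y Z.
        FArr F (g \<cdot>\<^bsub>A\<^esub> f) = FArr F g \<cdot>\<^bsub>B\<^esub> FArr F f)"

definition comp_func ::
    "('p, 'b, 'q, 'c) func \<Rightarrow> ('o, 'a, 'p, 'b) func \<Rightarrow> ('o, 'a, 'q, 'c) func" where
  "comp_func G F = \<lparr>FObj = (\<lambda>X. FObj G (FObj F X)), FArr = (\<lambda>f. FArr G (FArr F f))\<rparr>"

definition is_nat_iso ::
    "('o, 'a) cat \<Rightarrow> ('p, 'b) cat \<Rightarrow> ('o, 'a, 'p, 'b) func \<Rightarrow> ('o, 'a, 'p, 'b) func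
     \<Rightarrow> ('o \<Rightarrow> 'b) \<Rightarrow> bool" where
  "is_nat_iso A B F G \<eta> \<longleftrightarrow> is_functor A B F \<and> is_functor A B G \<and>
     (\<forall>X \<in> Obj A. \<eta> X \<in> Hom B (FObj F X) (FObj G X) \<and> is_iso B (\<eta> X)) \<and>
     (\<forall>f \<in> Arr A. FArr G f \<cdot>\<^bsub>B\<^esub> \<eta> (Dom A f) = \<eta> (Cod A f) \<cdot>\<^bsub>B\<^esub> FArr F f)"

definition naturally_isomorphic ::
    "('o, 'a) cat \<Rightarrow> ('p, 'b) cat \<Rightarrow> ('o, 'a, 'p, 'b) func \<Rightarrow> ('o, 'a, 'p, 'b) func \<Rightarrow> bool"
  where
  "naturally_isomorphic A B F G \<longleftrightarrow> (\<exists>\<eta>. is_nat_iso A B F G \<eta>)"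


section \<open>The category of categories and the duality functor\<close>

text \<open>
  The objects of \<open>Cat\<close> are all categories whose objects and arrows are drawn from two
  given types. An arrow carries its domain and codomain. Its functor is required to be
  \<^const>\<open>undefined\<close> outside the carriers of the domain, so that equality of arrows is
  equality of functors.
\<close>

type_synonym ('p, 'b) cat_arr =
  "('p, 'b) cat \<times> ('p, 'b, 'p, 'b) func \<times> ('p, 'b) cat"

definition restrict_func ::
    "('o, 'a) cat \<Rightarrow> ('o, 'a, 'p, 'b) func \<Rightarrow> ('o, 'a, 'p, 'b) func" where
  "restrict_func A F = \<lparr>FObj = restrict (FObj F) (Obj A), FArr = restrict (FArr F) (Arr A)\<rparr>"

definition Cat :: "(('p, 'b) cat, ('p, 'b) cat_arr) cat" where
  "Cat = \<lparr>
     Obj = {A. is_category A},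
     Arr = {(A, F, B). is_functor A B F \<and>
              FObj F \<in> extensional (Obj A) \<and> FArr F \<in> extensional (Arr A)},
     Dom = (\<lambda>(A, F, B). A),
     Cod = (\<lambda>(A, F, B). B),
     Ide = (\<lambda>A. (A, restrict_func A \<lparr>FObj = (\<lambda>X. X), FArr = (\<lambda>f. f)\<rparr>, A)),
     Comp = (\<lambda>(B, G, D) (A, F, B'). (A, restrict_func A (comp_func G F), D))\<rparr>"

definition op_cat :: "('o, 'a) cat \<Rightarrow> ('o, 'a) cat" where
  "op_cat A = \<lparr>Obj = Obj A, Arr = Arr A, Dom = Cod A, Cod = Dom A, Ide = Ide A,
               Comp = (\<lambda>g f. f \<cdot>\<^bsub>A\<^esub> g)\<rparr>"

definition op_functor ::
    "(('p, 'b) cat, ('p, 'b) cat_arr, ('p, 'b) cat, ('p, 'b) cat_arr) func" where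
  "op_functor = \<lparr>FObj = op_cat, FArr = (\<lambda>(A, F, B). (op_cat A, F, op_cat B))\<rparr>"


section \<open>Finite limits\<close>

definition is_terminal :: "('o, 'a) cat \<Rightarrow> 'o \<Rightarrow> bool" where
  "is_terminal C T \<longleftrightarrow> T \<in> Obj C \<and> (\<forall>X \<in> Obj C. \<exists>!t. t \<in> Hom C X T)"

text \<open>
  The square \<open>f \<cdot> p = g \<cdot> q\<close> exhibits \<open>p\<close> as the pullback of \<open>g\<close> along \<open>f\<close>,
  and \<open>q\<close> as the pullback of \<open>f\<close> along \<open>g\<close>.
\<close>

definition is_pullback :: "('o, 'a) cat \<Rightarrow> 'a \<Rightarrow> 'a \<Rightarrow> 'a \<Rightarrow> 'a \<Rightarrow> bool" where
  "is_pullback C p q f g \<longleftrightarrow>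
     f \<in> Arr C \<and> g \<in> Arr C \<and> Cod C f = Cod C g \<and>
     p \<in> Arr C \<and> q \<in> Arr C \<and> Dom C p = Dom C q \<and>
     Cod C p = Dom C f \<and> Cod C q = Dom C g \<and> f \<cdot>\<^bsub>C\<^esub> p = g \<cdot>\<^bsub>C\<^esub> q \<and>
     (\<forall>Z \<in> Obj C. \<forall>u \<in> Hom C Z (Dom C f). \<forall>v \<in> Hom C Z (Dom C g).
        f \<cdot>\<^bsub>C\<^esub> u = g \<cdot>\<^bsub>C\<^esub> v \<longrightarrow>
        (\<exists>!w. w \<in> Hom C Z (Dom C p) \<and> p \<cdot>\<^bsub>C\<^esub> w = u \<and> q \<cdot>\<^bsub>C\<^esub> w = v))"

definition is_cone ::
    "('j, 'i) cat \<Rightarrow> ('o, 'a) cat \<Rightarrow> ('j, 'i, 'o, 'a) func \<Rightarrow> 'o \<Rightarrow> ('j \<Rightarrow> 'a) \<Rightarrow> bool" where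
  "is_cone J C D L \<pi> \<longleftrightarrow> L \<in> Obj C \<and>
     (\<forall>j \<in> Obj J. \<pi> j \<in> Hom C L (FObj D j)) \<and>
     (\<forall>u \<in> Arr J. FArr D u \<cdot>\<^bsub>C\<^esub> \<pi> (Dom J u) = \<pi> (Cod J u))"

definition is_limit ::
    "('j, 'i) cat \<Rightarrow> ('o, 'a) cat \<Rightarrow> ('j, 'i, 'o, 'a) func \<Rightarrow> 'o \<Rightarrow> ('j \<Rightarrow> 'a) \<Rightarrow> bool" where
  "is_limit J C D L \<pi> \<longleftrightarrow> is_cone J C D L \<pi> \<and>
     (\<forall>Z \<rho>. is_cone J C D Z \<rho> \<longrightarrow>
        (\<exists>!h. h \<in> Hom C Z L \<and> (\<forall>j \<in> Obj J. \<pi> j \<cdot>\<^bsub>C\<^esub> h = \<rho> j)))"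

text \<open>
  Every finite category is isomorphic to one whose objects and arrows are natural numbers,
  so these suffice as diagram shapes.
\<close>

definition finitely_complete :: "('o, 'a) cat \<Rightarrow> bool" where
  "finitely_complete C \<longleftrightarrow> is_category C \<and>
     (\<forall>(J :: (nat, nat) cat) D. finite (Obj J) \<and> finite (Arr J) \<and> is_functor J C D \<longrightarrow>
        (\<exists>L \<pi>. is_limit J C D L \<pi>))"


section \<open>Balanced factorization categories\<close>

text \<open>The unique lifting property of \<open>e\<close> against \<open>m\<close>.\<close>

definition orthogonal :: "('o, 'a) cat \<Rightarrow> 'a \<Rightarrow> 'a \<Rightarrow> bool" where
  "orthogonal C e m \<longleftrightarrow>
     (\<forall>u \<in> Hom C (Dom C e) (Dom C m). \<forall>v \<in> Hom C (Cod C e) (Cod C m).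
        m \<cdot>\<^bsub>C\<^esub> u = v \<cdot>\<^bsub>C\<^esub> e \<longrightarrow>
        (\<exists>!w. w \<in> Hom C (Cod C e) (Dom C m) \<and> w \<cdot>\<^bsub>C\<^esub> e = u \<and> m \<cdot>\<^bsub>C\<^esub> w = v))"

text \<open>
  A factorization system consists of the classes \<open>\<E>\<close> (\<open>LCls\<close>) and \<open>\<M>\<close> (\<open>RCls\<close>)
  together with a chosen factorization \<open>f = RFac f \<cdot> LFac f\<close> of every arrow.
\<close>

record 'a fact_sys =
  LCls :: "'a set"
  RCls :: "'a set"
  LFac :: "'a \<Rightarrow> 'a"
  RFac :: "'a \<Rightarrow> 'a"

definition is_fact_sys :: "('o, 'a) cat \<Rightarrow> 'a fact_sys \<Rightarrow> bool" where
  "is_fact_sys C F \<longleftrightarrow>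
     LCls F = {e \<in> Arr C. \<forall>m \<in> RCls F. orthogonal C e m} \<and>
     RCls F = {m \<in> Arr C. \<forall>e \<in> LCls F. orthogonal C e m} \<and>
     (\<forall>f \<in> Arr C. LFac F f \<in> LCls F \<and> RFac F f \<in> RCls F \<and>
        Dom C (LFac F f) = Dom C f \<and> Cod C (RFac F f) = Cod C f \<and>
        Cod C (LFac F f) = Dom C (RFac F f) \<and> RFac F f \<cdot>\<^bsub>C\<^esub> LFac F f = f)"

text \<open>
  \<open>T\<close> is the chosen terminal object, \<open>F\<close> is \<open>(\<E>, \<M>)\<close> and \<open>F'\<close> is \<open>(\<E>', \<M>')\<close>.
\<close>

definition balanced_factorization_category ::
    "('o, 'a) cat \<Rightarrow> 'o \<Rightarrow> 'a fact_sys \<Rightarrow> 'a fact_sys \<Rightarrow> bool" where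
  "balanced_factorization_category C T F F' \<longleftrightarrow>
     is_category C \<and> finitely_complete C \<and> is_terminal C T \<and>
     is_fact_sys C F \<and> is_fact_sys C F' \<and>
     (\<forall>S \<in> Obj C. \<forall>t \<in> Hom C S T. t \<in> RCls F \<longleftrightarrow> t \<in> RCls F') \<and>
     (\<forall>p q e m. e \<in> LCls F \<and> m \<in> RCls F' \<and> is_pullback C p q m e \<longrightarrow> p \<in> LCls F) \<and>
     (\<forall>p q e m. e \<in> LCls F' \<and> m \<in> RCls F \<and> is_pullback C p q m e \<longrightarrow> p \<in> LCls F')"


section \<open>Underlying functors\<close>

text \<open>
  The following is stated for one factorization system \<open>F\<close> and hence yields both
  underlying functors. For \<open>(\<E>, \<M>)\<close> and a point \<open>x\<close> of \<open>X\<close>, the object \<open>slice C F x\<close> is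
  \<open>X/x\<close>, \<open>LFac F x\<close> is \<open>e\<^sub>x\<close> and \<open>RFac F x\<close> is \<open>\<down>x\<close>; for \<open>(\<E>', \<M>')\<close> they are the
  coslice \<open>x\X\<close>, \<open>i\<^sub>x\<close> and \<open>\<up>x\<close>.
\<close>

definition slice :: "('o, 'a) cat \<Rightarrow> 'a fact_sys \<Rightarrow> 'a \<Rightarrow> 'o" where
  "slice C F x = Cod C (LFac F x)"

text \<open>
  The map over \<open>X\<close> from \<open>X/x\<close> to \<open>X/y\<close> that corresponds to a map \<open>\<alpha>\<close> from
  \<open>1\<close> to \<open>X/y\<close> over \<open>x\<close>.
\<close>

definition hat :: "('o, 'a) cat \<Rightarrow> 'a fact_sys \<Rightarrow> 'a \<Rightarrow> 'a \<Rightarrow> 'a \<Rightarrow> 'a" where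
  "hat C F x \<alpha> y = (THE h. h \<in> Hom C (slice C F x) (slice C F y) \<and>
     RFac F y \<cdot>\<^bsub>C\<^esub> h = RFac F x \<and> h \<cdot>\<^bsub>C\<^esub> LFac F x = \<alpha>)"

text \<open>An arrow \<open>x \<rightarrow> y\<close> is recorded as \<open>(x, \<alpha>, y)\<close> with \<open>\<alpha>\<close> a map from \<open>1\<close> to \<open>X/y\<close> over \<open>x\<close>.\<close>

definition underlying_cat ::
    "('o, 'a) cat \<Rightarrow> 'o \<Rightarrow> 'a fact_sys \<Rightarrow> 'o \<Rightarrow> ('a, 'a \<times> 'a \<times> 'a) cat" where
  "underlying_cat C T F X = \<lparr>
     Obj = Hom C T X,
     Arr = {(x, \<alpha>, y). x \<in> Hom C T X \<and> y \<in> Hom C T X \<and>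
              \<alpha> \<in> Hom C T (slice C F y) \<and> RFac F y \<cdot>\<^bsub>C\<^esub> \<alpha> = x},
     Dom = (\<lambda>(x, \<alpha>, y). x),
     Cod = (\<lambda>(x, \<alpha>, y). y),
     Ide = (\<lambda>x. (x, LFac F x, x)),
     Comp = (\<lambda>(y, \<beta>, z) (x, \<alpha>, y'). (x, hat C F y \<beta> z \<cdot>\<^bsub>C\<^esub> \<alpha>, z))\<rparr>"

text \<open>The map \<open>e\<close> from \<open>X/x\<close> to \<open>Y/fx\<close> induced by \<open>f\<close> from \<open>X\<close> to \<open>Y\<close>.\<close>

definition slice_map :: "('o, 'a) cat \<Rightarrow> 'a fact_sys \<Rightarrow> 'a \<Rightarrow> 'a \<Rightarrow> 'a" where
  "slice_map C F f x = (THE e. e \<in> LCls F \<and>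
     e \<in> Hom C (slice C F x) (slice C F (f \<cdot>\<^bsub>C\<^esub> x)) \<and>
     RFac F (f \<cdot>\<^bsub>C\<^esub> x) \<cdot>\<^bsub>C\<^esub> e = f \<cdot>\<^bsub>C\<^esub> RFac F x \<and>
     e \<cdot>\<^bsub>C\<^esub> LFac F x = LFac F (f \<cdot>\<^bsub>C\<^esub> x))"

definition underlying_map ::
    "('o, 'a) cat \<Rightarrow> 'a fact_sys \<Rightarrow> 'a \<Rightarrow> ('a, 'a \<times> 'a \<times> 'a, 'a, 'a \<times> 'a \<times> 'a) func" where
  "underlying_map C F f = \<lparr>
     FObj = (\<lambda>x. f \<cdot>\<^bsub>C\<^esub> x),
     FArr = (\<lambda>(x, \<alpha>, y). (f \<cdot>\<^bsub>C\<^esub> x, slice_map C F f y \<cdot>\<^bsub>C\<^esub> \<alpha>, f \<cdot>\<^bsub>C\<^esub> y))\<rparr>"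

definition underlying_functor ::
    "('o, 'a) cat \<Rightarrow> 'o \<Rightarrow> 'a fact_sys
     \<Rightarrow> ('o, 'a, ('a, 'a \<times> 'a \<times> 'a) cat, ('a, 'a \<times> 'a \<times> 'a) cat_arr) func" where
  "underlying_functor C T F = \<lparr>
     FObj = underlying_cat C T F,
     FArr = (\<lambda>f. let A = underlying_cat C T F (Dom C f); B = underlying_cat C T F (Cod C f)
                 in (A, restrict_func A (underlying_map C F f), B))\<rparr>"

end

theory Submission
  imports Defs
begin

text \<open>
  For points \<open>x, y\<close> of \<open>X\<close> let \<open>[x, y]\<close> be the pullback of \<open>\<up>x\<close> and \<open>\<down>y\<close>. Call two points of an
  object connected if every map into an object over \<open>1\<close> by a map in \<open>\<M>\<close> identifies them; by
  \<open>\<M>/1 = \<M>'/1\<close> this does not depend on the factorization system. Balance makes the fibre of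
  \<open>[x, y]\<close> over \<open>e\<^sub>y\<close>, whose points are the arrows \<open>\<alpha>'\<close> from \<open>y\<close> to \<open>x\<close> of the right underlying
  category, a reflection of \<open>[x, y]\<close> into \<open>\<M>/1\<close>, so that every point is connected to exactly one
  point of the fibre. The same holds for the fibre over \<open>i\<^sub>x\<close>, whose points are the arrows \<open>\<alpha>\<close>
  from \<open>x\<close> to \<open>y\<close> of the left one. Hence \<open>(i\<^sub>x, \<alpha>) \<sim> (\<alpha>', e\<^sub>y)\<close> is a bijective
  correspondence; it is functorial and natural because maps of pullbacks preserve connectedness.
\<close>

section \<open>Categories and pullbacks\<close>

locale category =
  fixes C :: "('o, 'a) cat" (structure)
  assumes is_category: "is_category C"
begin

lemma homD:
  assumes "f \<in> Hom C X Y"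
  shows "f \<in> Arr C" "Dom C f = X" "Cod C f = Y" "X \<in> Obj C" "Y \<in> Obj C"
  using assms is_category unfolding Hom_def is_category_def by auto

lemma arr_hom: "f \<in> Arr C \<Longrightarrow> f \<in> Hom C (Dom C f) (Cod C f)"
  by (simp add: Hom_def)

lemma ide_hom: "X \<in> Obj C \<Longrightarrow> Ide C X \<in> Hom C X X"
  using is_category unfolding is_category_def by blast

lemma comp_hom: "f \<in> Hom C X Y \<Longrightarrow> g \<in> Hom C Y Z \<Longrightarrow> g \<cdot> f \<in> Hom C X Z"
  using is_category unfolding is_category_def by blast

lemma comp_ide:
  assumes "f \<in> Hom C X Y"
  shows "f \<cdot> Ide C X = f" "Ide C Y \<cdot> f = f"
  using assms is_category unfolding is_category_def Hom_def by auto

lemma assoc: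
  "f \<in> Hom C W X \<Longrightarrow> g \<in> Hom C X Y \<Longrightarrow> h \<in> Hom C Y Z \<Longrightarrow> (h \<cdot> g) \<cdot> f = h \<cdot> (g \<cdot> f)"
  using is_category unfolding is_category_def by blast

lemma pullback_homs:
  assumes "is_pullback C p q f g"
  shows "p \<in> Hom C (Dom C p) (Dom C f)" "q \<in> Hom C (Dom C p) (Dom C g)"
    "f \<in> Hom C (Dom C f) (Cod C f)" "g \<in> Hom C (Dom C g) (Cod C f)" "f \<cdot> p = g \<cdot> q"
  using assms unfolding is_pullback_def Hom_def by auto

lemma pullback_lift:
  assumes "is_pullback C p q f g"
    and "u \<in> Hom C Z (Dom C f)" "v \<in> Hom C Z (Dom C g)" "f \<cdot> u = g \<cdot> v"
  obtains w where "w \<in> Hom C Z (Dom C p)" "p \<cdot> w = u" "q \<cdot> w = v"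
  using assms homD(4)[OF assms(2)] unfolding is_pullback_def by blast

text \<open>Both maps mediate the cone formed by their common composites with the legs, so
  uniqueness of mediating maps identifies them: the legs are jointly monic.\<close>

lemma pullback_ext:
  assumes pb: "is_pullback C p q f g"
    and w: "w \<in> Hom C Z (Dom C p)" and w': "w' \<in> Hom C Z (Dom C p)"
    and eq: "p \<cdot> w = p \<cdot> w'" "q \<cdot> w = q \<cdot> w'"
  shows "w = w'"
proof -
  note h = pullback_homs[OF pb]
  have "f \<cdot> (p \<cdot> w) = g \<cdot> (q \<cdot> w)"
    using assoc[OF w h(1,3)] assoc[OF w h(2,4)] h(5) by simp
  moreover have "p \<cdot> w \<in> Hom C Z (Dom C f)" "q \<cdot> w \<in> Hom C Z (Dom C g)"
    using comp_hom[OF w h(1)] comp_hom[OF w h(2)] .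
  ultimately have "\<exists>!v. v \<in> Hom C Z (Dom C p) \<and> p \<cdot> v = p \<cdot> w \<and> q \<cdot> v = q \<cdot> w"
    using pb homD(4)[OF w] unfolding is_pullback_def by blast
  then show ?thesis using w w' eq by metis
qed

lemma pullback_swap:
  assumes "is_pullback C p q f g"
  shows "is_pullback C q p g f"
proof -
  have "\<exists>!w. w \<in> Hom C Z (Dom C q) \<and> q \<cdot> w = u \<and> p \<cdot> w = v"
    if "Z \<in> Obj C" "u \<in> Hom C Z (Dom C g)" "v \<in> Hom C Z (Dom C f)" "g \<cdot> u = f \<cdot> v" for Z u v
  proof -
    have "f \<cdot> v = g \<cdot> u" using that(4) by simp
    then have "\<exists>!w. w \<in> Hom C Z (Dom C p) \<and> p \<cdot> w = v \<and> q \<cdot> w = u"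
      using assms that(1-3) unfolding is_pullback_def by blast
    moreover have "Dom C p = Dom C q" using assms unfolding is_pullback_def by simp
    ultimately show ?thesis by (simp add: conj_ac)
  qed
  with assms show ?thesis unfolding is_pullback_def by simp
qed

end

text \<open>Arrows 0, 1, 2 are the identities; 3 and 4 are the legs, from 0 and 1 into 2. A
  composable pair contains an identity, so its composite is the other member. Numbers are used
  because \<open>finitely_complete\<close> takes its shapes from \<open>nat\<close>.\<close>

definition cospan :: "(nat, nat) cat" where
  "cospan = \<lparr>Obj = {0, 1, 2}, Arr = {0, 1, 2, 3, 4},
     Dom = (\<lambda>a. if a = 3 then 0 else if a = 4 then 1 else a),
     Cod = (\<lambda>a. if a = 3 \<or> a = 4 then 2 else a),
     Ide = (\<lambda>x. x), Comp = (\<lambda>g f. if g = 3 \<or> g = 4 then g else f)\<rparr>"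

lemma is_category_cospan: "is_category cospan"
proof -
  \<comment> \<open>With this choice of values \<open>Comp\<close> is associative on all triples of
    numbers, which spares a case analysis over the composable ones.\<close>
  have "(h \<cdot>\<^bsub>cospan\<^esub> g) \<cdot>\<^bsub>cospan\<^esub> f = h \<cdot>\<^bsub>cospan\<^esub> (g \<cdot>\<^bsub>cospan\<^esub> f)" for f g h
    by (simp add: cospan_def)
  then show ?thesis
    unfolding is_category_def by (simp add: cospan_def Hom_def)
qed

text \<open>The limit of the diagram of shape \<open>cospan\<close> given by \<open>f\<close> and
  \<open>g\<close> is the pullback once its leg at 2 is forgotten, that leg being the common
  composite of the other two with \<open>f\<close> and \<open>g\<close>.\<close>

lemma (in category) ex_pullback:
  assumes fc: "finitely_complete C" and f: "f \<in> Hom C A X" and g: "g \<in> Hom C B X"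
  shows "\<exists>p q. is_pullback C p q f g"
proof -
  note hf = homD[OF f] and hg = homD[OF g]
  define D :: "(nat, nat, 'o, 'a) func" where
    "D = \<lparr>FObj = (\<lambda>j. if j = 0 then A else if j = 1 then B else X),
          FArr = (\<lambda>a. if a = 0 then Ide C A else if a = 1 then Ide C B
                    else if a = 2 then Ide C X else if a = 3 then f else g)\<rparr>"
  have ide: "Ide C A \<in> Hom C A A" "Ide C B \<in> Hom C B B" "Ide C X \<in> Hom C X X"
    using ide_hom hf hg by auto
  have "is_functor cospan C D"
    unfolding is_functor_def
  proof (intro conjI ballI allI)
    show "is_category cospan" "is_category C" by (fact is_category_cospan is_category)+
    show "FObj D j \<in> Obj C" if "j \<in> Obj cospan" for j
      using that hf hg by (simp add: D_def)
    show "FArr D a \<in> Hom C (FObj D (Dom cospan a)) (FObj D (Cod cospan a))"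
      if "a \<in> Arr cospan" for a
      using that f g ide by (auto simp: D_def cospan_def)
    show "FArr D (Ide cospan j) = Ide C (FObj D j)" if "j \<in> Obj cospan" for j
      using that by (auto simp: D_def cospan_def)
    show "FArr D (b \<cdot>\<^bsub>cospan\<^esub> a) = FArr D b \<cdot> FArr D a"
      if "a \<in> Hom cospan i j" "b \<in> Hom cospan j k" for i j k a b
    proof -
      have "a \<in> {0, 1, 2, 3, 4}" "b \<in> {0, 1, 2, 3, 4}" "Cod cospan a = Dom cospan b"
        using that by (auto simp: Hom_def cospan_def)
      then show ?thesis
        by (elim insertE emptyE) (simp_all add: D_def cospan_def comp_ide[OF f] comp_ide[OF g]
          comp_ide[OF ide(1)] comp_ide[OF ide(2)] comp_ide[OF ide(3)])
    qed
  qed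
  moreover have "finite (Obj cospan)" "finite (Arr cospan)"
    by (simp_all add: cospan_def)
  ultimately obtain L \<pi> where lim: "is_limit cospan C D L \<pi>"
    using fc unfolding finitely_complete_def by blast
  \<comment> \<open>The cone condition is trivial at the identities, and at the arrows 3 and 4 it
    determines the leg at 2; a cone is thus a commuting square.\<close>
  have cone: "is_cone cospan C D Z \<rho> \<longleftrightarrow> \<rho> 0 \<in> Hom C Z A \<and> \<rho> 1 \<in> Hom C Z B \<and>
      f \<cdot> \<rho> 0 = \<rho> 2 \<and> g \<cdot> \<rho> 1 = \<rho> 2" for Z \<rho>
    unfolding is_cone_def
    using comp_ide comp_hom[of "\<rho> 0" Z A f X] f homD(4)
    by (auto simp: cospan_def D_def split: if_splits)
  have \<pi>: "\<pi> 0 \<in> Hom C L A" "\<pi> 1 \<in> Hom C L B" "f \<cdot> \<pi> 0 = \<pi> 2" "g \<cdot> \<pi> 1 = \<pi> 2"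
    using lim unfolding is_limit_def cone by auto
  have "\<exists>!w. w \<in> Hom C Z L \<and> \<pi> 0 \<cdot> w = u \<and> \<pi> 1 \<cdot> w = v"
    if u: "u \<in> Hom C Z A" and v: "v \<in> Hom C Z B" and eq: "f \<cdot> u = g \<cdot> v" for Z u v
  proof -
    define \<rho> where "\<rho> j = (if j = 0 then u else if j = 1 then v else f \<cdot> u)" for j :: nat
    have "is_cone cospan C D Z \<rho>" unfolding cone using u v eq by (simp add: \<rho>_def)
    then have ex: "\<exists>!h. h \<in> Hom C Z L \<and> (\<forall>j \<in> Obj cospan. \<pi> j \<cdot> h = \<rho> j)"
      using lim unfolding is_limit_def by blast
    have "(\<forall>j \<in> Obj cospan. \<pi> j \<cdot> h = \<rho> j) \<longleftrightarrow> \<pi> 0 \<cdot> h = u \<and> \<pi> 1 \<cdot> h = v"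
      if "h \<in> Hom C Z L" for h
      using assoc[OF that \<pi>(1) f] \<pi>(3) by (auto simp: cospan_def \<rho>_def)
    with ex show ?thesis by (smt (verit, best))
  qed
  then have "is_pullback C (\<pi> 0) (\<pi> 1) f g"
    unfolding is_pullback_def using hf hg homD[OF \<pi>(1)] homD[OF \<pi>(2)] \<pi> by simp
  then show ?thesis by blast
qed


section \<open>Factorization systems\<close>

locale fact_system = category +
  fixes F :: "'a fact_sys"
  assumes is_fact_sys: "is_fact_sys C F"
begin

lemma LCls_iff: "e \<in> LCls F \<longleftrightarrow> e \<in> Arr C \<and> (\<forall>m \<in> RCls F. orthogonal C e m)"
  using is_fact_sys unfolding is_fact_sys_def by blast

lemma RCls_iff: "m \<in> RCls F \<longleftrightarrow> m \<in> Arr C \<and> (\<forall>e \<in> LCls F. orthogonal C e m)"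
  using is_fact_sys unfolding is_fact_sys_def by blast

lemma lift_ex1:
  assumes "e \<in> LCls F" "m \<in> RCls F" "e \<in> Hom C A B" "m \<in> Hom C D E"
    "u \<in> Hom C A D" "v \<in> Hom C B E" "m \<cdot> u = v \<cdot> e"
  shows "\<exists>!w. w \<in> Hom C B D \<and> w \<cdot> e = u \<and> m \<cdot> w = v"
proof -
  have "orthogonal C e m" using assms(1,2) LCls_iff by blast
  then show ?thesis unfolding orthogonal_def homD(2,3)[OF assms(3)] homD(2,3)[OF assms(4)]
    using assms(5-7) by blast
qed

text \<open>Both maps are diagonals of the square with top \<open>w \<cdot> e\<close> and bottom
  \<open>m \<cdot> w\<close>.\<close>

lemma lift_ext:
  assumes e: "e \<in> LCls F" "e \<in> Hom C A B" and m: "m \<in> RCls F" "m \<in> Hom C D E"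
    and w: "w \<in> Hom C B D" "w' \<in> Hom C B D" and eq: "w \<cdot> e = w' \<cdot> e" "m \<cdot> w = m \<cdot> w'"
  shows "w = w'"
proof -
  have "m \<cdot> (w \<cdot> e) = (m \<cdot> w) \<cdot> e" using assoc[OF e(2) w(1) m(2)] by simp
  from lift_ex1[OF e(1) m(1) e(2) m(2) comp_hom[OF e(2) w(1)] comp_hom[OF w(1) m(2)] this]
  show ?thesis using w eq by metis
qed

lemma orthogonalI:
  assumes "e \<in> Hom C A B" "m \<in> Hom C D E"
    and ex: "\<And>u v. u \<in> Hom C A D \<Longrightarrow> v \<in> Hom C B E \<Longrightarrow> m \<cdot> u = v \<cdot> e \<Longrightarrow>
      \<exists>w. w \<in> Hom C B D \<and> w \<cdot> e = u \<and> m \<cdot> w = v"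
    and ext: "\<And>w w'. w \<in> Hom C B D \<Longrightarrow> w' \<in> Hom C B D \<Longrightarrow>
      w \<cdot> e = w' \<cdot> e \<Longrightarrow> m \<cdot> w = m \<cdot> w' \<Longrightarrow> w = w'"
  shows "orthogonal C e m"
  unfolding orthogonal_def homD(2,3)[OF assms(1)] homD(2,3)[OF assms(2)]
proof (intro ballI impI ex_ex1I)
  fix u v assume "u \<in> Hom C A D" "v \<in> Hom C B E" "m \<cdot> u = v \<cdot> e"
  then show "\<exists>w. w \<in> Hom C B D \<and> w \<cdot> e = u \<and> m \<cdot> w = v" by (rule ex)
qed (use ext in auto)

text \<open>A square from \<open>e\<close> to \<open>q\<close>, extended along \<open>p\<close> and
  \<open>g\<close>, is a square from \<open>e\<close> to \<open>f\<close>; its diagonal and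
  \<open>v\<close> together induce a map into the pullback. Later this places the legs of
  \<open>[x, y]\<close>, and the maps from their fibres to 1, in the right classes.\<close>

lemma RCls_pullback:
  assumes pb: "is_pullback C p q f g" and f: "f \<in> RCls F"
  shows "q \<in> RCls F"
  unfolding RCls_iff
proof (intro conjI ballI)
  note h = pullback_homs[OF pb]
  show "q \<in> Arr C" using homD(1)[OF h(2)] .
  fix e assume e: "e \<in> LCls F"
  then obtain A B where eh: "e \<in> Hom C A B" using LCls_iff arr_hom by blast
  show "orthogonal C e q"
  proof (rule orthogonalI[OF eh h(2)])
    fix u v
    assume u: "u \<in> Hom C A (Dom C p)" and v: "v \<in> Hom C B (Dom C g)" and sq: "q \<cdot> u = v \<cdot> e"
    have pu: "p \<cdot> u \<in> Hom C A (Dom C f)" using comp_hom[OF u h(1)] .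
    have gv: "g \<cdot> v \<in> Hom C B (Cod C f)" using comp_hom[OF v h(4)] .
    have "f \<cdot> (p \<cdot> u) = (g \<cdot> v) \<cdot> e"
      using assoc[OF u h(1,3)] assoc[OF u h(2,4)] assoc[OF eh v h(4)] h(5) sq by simp
    then obtain w where w: "w \<in> Hom C B (Dom C f)" "w \<cdot> e = p \<cdot> u" "f \<cdot> w = g \<cdot> v"
      using lift_ex1[OF e f eh h(3) pu gv] by blast
    obtain k where k: "k \<in> Hom C B (Dom C p)" "p \<cdot> k = w" "q \<cdot> k = v"
      using pullback_lift[OF pb w(1) v w(3)] by blast
    have "k \<cdot> e = u"
      by (rule pullback_ext[OF pb comp_hom[OF eh k(1)] u])
        (use assoc[OF eh k(1) h(1)] assoc[OF eh k(1) h(2)] k w sq in simp_all)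
    with k show "\<exists>k. k \<in> Hom C B (Dom C p) \<and> k \<cdot> e = u \<and> q \<cdot> k = v" by blast
  next
    fix w w'
    assume w: "w \<in> Hom C B (Dom C p)" and w': "w' \<in> Hom C B (Dom C p)"
      and eq: "w \<cdot> e = w' \<cdot> e" "q \<cdot> w = q \<cdot> w'"
    \<comment> \<open>Agreement after \<open>q\<close> gives agreement after
      \<open>f \<cdot> p = g \<cdot> q\<close>, so both composites with \<open>p\<close> are
      diagonals of one square from \<open>e\<close> to \<open>f\<close>.\<close>
    have "p \<cdot> w = p \<cdot> w'"
      by (rule lift_ext[OF e eh f h(3) comp_hom[OF w h(1)] comp_hom[OF w' h(1)]])
        (use assoc[OF eh w h(1)] assoc[OF eh w' h(1)] assoc[OF w h(1,3)] assoc[OF w' h(1,3)]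
          assoc[OF w h(2,4)] assoc[OF w' h(2,4)] h(5) eq in simp_all)
    then show "w = w'" using pullback_ext[OF pb w w'] eq by simp
  qed
qed

text \<open>Precomposition with \<open>e\<close> turns a square from \<open>w\<close> to
  \<open>m\<close> into one from \<open>w \<cdot> e\<close> to \<open>m\<close>. The diagonal of the
  latter serves for the former, its upper triangle being checked by uniqueness of lifts against
  \<open>e\<close>.\<close>

lemma LCls_cancel:
  assumes e: "e \<in> LCls F" "e \<in> Hom C A B" and w: "w \<in> Hom C B D" and we: "w \<cdot> e \<in> LCls F"
  shows "w \<in> LCls F"
  unfolding LCls_iff
proof (intro conjI ballI)
  show "w \<in> Arr C" using homD(1)[OF w] .
  fix m assume m: "m \<in> RCls F"
  then obtain M N where mh: "m \<in> Hom C M N" using RCls_iff arr_hom by blast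
  have weh: "w \<cdot> e \<in> Hom C A D" using comp_hom[OF e(2) w] .
  show "orthogonal C w m"
  proof (rule orthogonalI[OF w mh])
    fix u v assume u: "u \<in> Hom C B M" and v: "v \<in> Hom C D N" and sq: "m \<cdot> u = v \<cdot> w"
    have "m \<cdot> (u \<cdot> e) = v \<cdot> (w \<cdot> e)"
      using assoc[OF e(2) u mh] assoc[OF e(2) w v] sq by simp
    then obtain l where l: "l \<in> Hom C D M" "l \<cdot> (w \<cdot> e) = u \<cdot> e" "m \<cdot> l = v"
      using lift_ex1[OF we m weh mh comp_hom[OF e(2) u] v] by blast
    have "l \<cdot> w = u"
      by (rule lift_ext[OF e m mh comp_hom[OF w l(1)] u])
        (use assoc[OF e(2) w l(1)] assoc[OF w l(1) mh] l sq in simp_all)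
    with l show "\<exists>l. l \<in> Hom C D M \<and> l \<cdot> w = u \<and> m \<cdot> l = v" by blast
  next
    fix l l' assume l: "l \<in> Hom C D M" "l' \<in> Hom C D M" and "l \<cdot> w = l' \<cdot> w" "m \<cdot> l = m \<cdot> l'"
    then show "l = l'"
      using lift_ext[OF we weh m mh l] assoc[OF e(2) w l(1)] assoc[OF e(2) w l(2)] by simp
  qed
qed

section \<open>Slices and the maps between them\<close>

lemma fac:
  assumes "x \<in> Hom C T X"
  shows "LFac F x \<in> LCls F" "RFac F x \<in> RCls F" "LFac F x \<in> Hom C T (slice C F x)"
    "RFac F x \<in> Hom C (slice C F x) X" "RFac F x \<cdot> LFac F x = x"
proof -
  have "LFac F x \<in> LCls F \<and> RFac F x \<in> RCls F \<and>
        Dom C (LFac F x) = Dom C x \<and> Cod C (RFac F x) = Cod C x \<and>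
        Cod C (LFac F x) = Dom C (RFac F x) \<and> RFac F x \<cdot> LFac F x = x"
    using is_fact_sys homD(1)[OF assms] unfolding is_fact_sys_def by blast
  moreover from this have "LFac F x \<in> Arr C" "RFac F x \<in> Arr C"
    using LCls_iff[of "LFac F x"] RCls_iff[of "RFac F x"] by blast+
  ultimately show "LFac F x \<in> LCls F" "RFac F x \<in> RCls F" "LFac F x \<in> Hom C T (slice C F x)"
    "RFac F x \<in> Hom C (slice C F x) X" "RFac F x \<cdot> LFac F x = x"
    using homD(2,3)[OF assms] unfolding Hom_def slice_def by simp_all
qed

lemma slice_ext:
  assumes x: "x \<in> Hom C T X" and y: "y \<in> Hom C U Y"
    and h: "h \<in> Hom C (slice C F x) (slice C F y)" "h' \<in> Hom C (slice C F x) (slice C F y)"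
    and eq: "h \<cdot> LFac F x = h' \<cdot> LFac F x" "RFac F y \<cdot> h = RFac F y \<cdot> h'"
  shows "h = h'"
  using lift_ext[OF fac(1)[OF x] fac(3)[OF x] fac(2)[OF y] fac(4)[OF y] h eq] .

text \<open>The map sought is the diagonal of a square from \<open>e\<^sub>x\<close> to
  \<open>\<down>y\<close>. Both induced maps arise so: \<open>hat\<close> for \<open>f\<close> the
  identity, \<open>slice_map\<close> for \<open>y\<close> the point \<open>f \<cdot> x\<close> and
  \<open>\<alpha>\<close> its left factor.\<close>

lemma slice_lift_ex1:
  assumes x: "x \<in> Hom C T X" and y: "y \<in> Hom C U Y" and f: "f \<in> Hom C X Y"
    and \<alpha>: "\<alpha> \<in> Hom C T (slice C F y)" "RFac F y \<cdot> \<alpha> = f \<cdot> x"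
  shows "\<exists>!h. h \<in> Hom C (slice C F x) (slice C F y) \<and> h \<cdot> LFac F x = \<alpha> \<and>
    RFac F y \<cdot> h = f \<cdot> RFac F x"
proof (rule lift_ex1[OF fac(1)[OF x] fac(2)[OF y] fac(3)[OF x] fac(4)[OF y] \<alpha>(1)])
  show "f \<cdot> RFac F x \<in> Hom C (slice C F x) Y" using comp_hom[OF fac(4)[OF x] f] .
  show "RFac F y \<cdot> \<alpha> = f \<cdot> RFac F x \<cdot> LFac F x"
    using assoc[OF fac(3,4)[OF x] f] fac(5)[OF x] \<alpha>(2) by simp
qed

lemma hat:
  assumes x: "x \<in> Hom C T X" and y: "y \<in> Hom C U X"
    and \<alpha>: "\<alpha> \<in> Hom C T (slice C F y)" "RFac F y \<cdot> \<alpha> = x"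
  shows "hat C F x \<alpha> y \<in> Hom C (slice C F x) (slice C F y)"
    "RFac F y \<cdot> hat C F x \<alpha> y = RFac F x" "hat C F x \<alpha> y \<cdot> LFac F x = \<alpha>"
proof -
  have i: "Ide C X \<in> Hom C X X" using ide_hom homD(5)[OF x] .
  have "\<exists>!h. h \<in> Hom C (slice C F x) (slice C F y) \<and> RFac F y \<cdot> h = RFac F x \<and> h \<cdot> LFac F x = \<alpha>"
    using slice_lift_ex1[OF x y i \<alpha>(1)] \<alpha>(2) comp_ide[OF x] comp_ide[OF fac(4)[OF x]]
    by (simp add: conj_ac)
  from theI'[OF this]
  show "hat C F x \<alpha> y \<in> Hom C (slice C F x) (slice C F y)"
    "RFac F y \<cdot> hat C F x \<alpha> y = RFac F x" "hat C F x \<alpha> y \<cdot> LFac F x = \<alpha>"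
    unfolding hat_def by simp_all
qed

lemma slice_map:
  assumes x: "x \<in> Hom C T X" and f: "f \<in> Hom C X Y"
  shows "slice_map C F f x \<in> Hom C (slice C F x) (slice C F (f \<cdot> x))"
    "RFac F (f \<cdot> x) \<cdot> slice_map C F f x = f \<cdot> RFac F x"
    "slice_map C F f x \<cdot> LFac F x = LFac F (f \<cdot> x)"
proof -
  have fx: "f \<cdot> x \<in> Hom C T Y" using comp_hom[OF x f] .
  note e = fac(1)[OF x] fac(3)[OF x]
  have ex1: "\<exists>!h. h \<in> Hom C (slice C F x) (slice C F (f \<cdot> x)) \<and> h \<cdot> LFac F x = LFac F (f \<cdot> x) \<and>
      RFac F (f \<cdot> x) \<cdot> h = f \<cdot> RFac F x"
    using slice_lift_ex1[OF x fx f fac(3)[OF fx]] fac(5)[OF fx] by simp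
  \<comment> \<open>Membership in the left class, which \<open>slice_map\<close> demands, follows by
    cancellation: \<open>h\<close> composed with \<open>LFac F x\<close> is the left factor of
    \<open>f \<cdot> x\<close>.\<close>
  have "h \<in> LCls F" if "h \<in> Hom C (slice C F x) (slice C F (f \<cdot> x))"
    "h \<cdot> LFac F x = LFac F (f \<cdot> x)" for h
    using LCls_cancel[OF e that(1)] that(2) fac(1)[OF fx] by simp
  with ex1 have "\<exists>!h. h \<in> LCls F \<and> h \<in> Hom C (slice C F x) (slice C F (f \<cdot> x)) \<and>
      RFac F (f \<cdot> x) \<cdot> h = f \<cdot> RFac F x \<and> h \<cdot> LFac F x = LFac F (f \<cdot> x)"
    by (smt (verit, best))
  from theI'[OF this]
  show "slice_map C F f x \<in> Hom C (slice C F x) (slice C F (f \<cdot> x))"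
    "RFac F (f \<cdot> x) \<cdot> slice_map C F f x = f \<cdot> RFac F x"
    "slice_map C F f x \<cdot> LFac F x = LFac F (f \<cdot> x)"
    unfolding slice_map_def by simp_all
qed

end

section \<open>The category of categories\<close>

lemma func_eqI:
  fixes G H :: "('o, 'a, 'p, 'b) func"
  assumes "FObj G = FObj H" "FArr G = FArr H"
  shows "G = H"
  using assms by (cases G; cases H) simp

lemma restrict_func_cong:
  assumes "\<And>X. X \<in> Obj A \<Longrightarrow> FObj G X = FObj H X" "\<And>f. f \<in> Arr A \<Longrightarrow> FArr G f = FArr H f"
  shows "restrict_func A G = restrict_func A H"
  using assms unfolding restrict_func_def by (auto intro!: restrict_ext)

lemma restrict_func_extensional:
  fixes G :: "('o, 'a, 'p, 'b) func"
  assumes "FObj G \<in> extensional (Obj A)" "FArr G \<in> extensional (Arr A)"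
  shows "restrict_func A G = G"
  using assms by (intro func_eqI) (simp_all add: restrict_func_def extensional_restrict)

lemma restrict_func_apply [simp]:
  "X \<in> Obj A \<Longrightarrow> FObj (restrict_func A G) X = FObj G X"
  "f \<in> Arr A \<Longrightarrow> FArr (restrict_func A G) f = FArr G f"
  by (simp_all add: restrict_func_def)

lemma comp_func_apply [simp]:
  "FObj (comp_func G F) X = FObj G (FObj F X)" "FArr (comp_func G F) f = FArr G (FArr F f)"
  by (simp_all add: comp_func_def)

lemma is_functorD:
  assumes "is_functor A B G"
  shows "is_category A" "is_category B" "X \<in> Obj A \<Longrightarrow> FObj G X \<in> Obj B"
    "f \<in> Arr A \<Longrightarrow> FArr G f \<in> Hom B (FObj G (Dom A f)) (FObj G (Cod A f))"
    "f \<in> Arr A \<Longrightarrow> FArr G f \<in> Arr B"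
    "X \<in> Obj A \<Longrightarrow> FArr G (Ide A X) = Ide B (FObj G X)"
    "f \<in> Hom A X Y \<Longrightarrow> g \<in> Hom A Y Z \<Longrightarrow> FArr G (g \<cdot>\<^bsub>A\<^esub> f) = FArr G g \<cdot>\<^bsub>B\<^esub> FArr G f"
  using assms unfolding is_functor_def Hom_def by blast+

lemma is_functor_restrict:
  assumes G: "is_functor A B G"
  shows "is_functor A B (restrict_func A G)"
proof -
  interpret category A by unfold_locales (rule is_functorD(1)[OF G])
  show ?thesis
    unfolding is_functor_def
  proof (intro conjI ballI allI)
    show "FArr (restrict_func A G) (g \<cdot>\<^bsub>A\<^esub> f) =
        FArr (restrict_func A G) g \<cdot>\<^bsub>B\<^esub> FArr (restrict_func A G) f"
      if "f \<in> Hom A X Y" "g \<in> Hom A Y Z" for X Y Z f g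
      using is_functorD(7)[OF G that] homD(1)[OF comp_hom[OF that]] homD(1)[OF that(1)]
        homD(1)[OF that(2)]
      by simp
  qed (use is_functorD[OF G] homD(4,5)[OF arr_hom] homD(1)[OF ide_hom] in simp_all)
qed

lemma is_functor_comp:
  assumes F: "is_functor A B F" and G: "is_functor B D G"
  shows "is_functor A D (comp_func G F)"
proof -
  interpret A: category A by unfold_locales (rule is_functorD(1)[OF F])
  interpret B: category B by unfold_locales (rule is_functorD(2)[OF F])
  show ?thesis
    unfolding is_functor_def
  proof (intro conjI ballI allI)
    fix f assume f: "f \<in> Arr A"
    note h = is_functorD(4)[OF F f]
    show "FArr (comp_func G F) f \<in>
        Hom D (FObj (comp_func G F) (Dom A f)) (FObj (comp_func G F) (Cod A f))"
      using is_functorD(4)[OF G B.homD(1)[OF h]] B.homD(2,3)[OF h] by simp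
  next
    fix X Y Z f g assume f: "f \<in> Hom A X Y" and g: "g \<in> Hom A Y Z"
    note hf = is_functorD(4)[OF F A.homD(1)[OF f]] and hg = is_functorD(4)[OF F A.homD(1)[OF g]]
    show "FArr (comp_func G F) (g \<cdot>\<^bsub>A\<^esub> f) =
        FArr (comp_func G F) g \<cdot>\<^bsub>D\<^esub> FArr (comp_func G F) f"
      using is_functorD(7)[OF F f g] is_functorD(7)[OF G] hf hg A.homD(2,3)[OF f]
        A.homD(2,3)[OF g]
      by simp
  qed (use is_functorD[OF F] is_functorD[OF G] in simp_all)
qed

lemma Cat_Hom_iff:
  "\<Phi> \<in> Hom Cat A B \<longleftrightarrow> (\<exists>G. \<Phi> = (A, G, B) \<and> is_functor A B G \<and>
     FObj G \<in> extensional (Obj A) \<and> FArr G \<in> extensional (Arr A))"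
  by (auto simp: Hom_def Cat_def)

lemma Cat_HomI: "is_functor A B G \<Longrightarrow> (A, restrict_func A G, B) \<in> Hom Cat A B"
  unfolding Cat_Hom_iff by (auto simp: is_functor_restrict) (auto simp: restrict_func_def)

text \<open>An extensional functor equals its own restriction, so every arrow of \<open>Cat\<close>
  has the form built by \<open>Cat_HomI\<close>. Equations between arrows then reduce to agreement
  on carriers, by \<open>restrict_func_cong\<close>.\<close>

lemma Cat_HomE:
  assumes "\<Phi> \<in> Hom Cat A B"
  obtains G where "\<Phi> = (A, restrict_func A G, B)" "is_functor A B G"
  using assms unfolding Cat_Hom_iff by (metis restrict_func_extensional)

lemma Cat_comp:
  "(B, G, D) \<cdot>\<^bsub>Cat\<^esub> (A, F, B') = (A, restrict_func A (comp_func G F), D)"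
  by (simp add: Cat_def)

text \<open>A functor maps carriers into carriers, so the inner restrictions change no value that
  the composite uses; only the outer one remains.\<close>

lemma Cat_comp_restrict:
  assumes "is_functor A B F"
  shows "(B, restrict_func B G, D) \<cdot>\<^bsub>Cat\<^esub> (A, restrict_func A F, B) =
    (A, restrict_func A (comp_func G F), D)"
  unfolding Cat_comp using is_functorD(3,5)[OF assms] by (auto intro!: restrict_func_cong)

lemma Cat_Ide: "Ide Cat A = (A, restrict_func A \<lparr>FObj = (\<lambda>X. X), FArr = (\<lambda>f. f)\<rparr>, A)"
  by (simp add: Cat_def)

lemma is_functor_id:
  assumes "is_category A"
  shows "is_functor A A \<lparr>FObj = (\<lambda>X. X), FArr = (\<lambda>f. f)\<rparr>"
proof -
  interpret category A by unfold_locales (rule assms)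
  show ?thesis using assms arr_hom by (simp add: is_functor_def)
qed

lemma is_category_Cat: "is_category Cat"
  unfolding is_category_def
proof (intro conjI ballI allI)
  fix \<Phi> assume "\<Phi> \<in> Arr Cat"
  then have "\<Phi> \<in> Hom Cat (Dom Cat \<Phi>) (Cod Cat \<Phi>)" by (simp add: Hom_def)
  then obtain G where \<Phi>: "\<Phi> = (Dom Cat \<Phi>, restrict_func (Dom Cat \<Phi>) G, Cod Cat \<Phi>)"
    and G: "is_functor (Dom Cat \<Phi>) (Cod Cat \<Phi>) G"
    by (rule Cat_HomE)
  show "Dom Cat \<Phi> \<in> Obj Cat" "Cod Cat \<Phi> \<in> Obj Cat"
    using is_functorD(1,2)[OF G] by (simp_all add: Cat_def)
  show "\<Phi> \<cdot>\<^bsub>Cat\<^esub> Ide Cat (Dom Cat \<Phi>) = \<Phi>"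
    by (subst (1 3) \<Phi>, unfold Cat_Ide,
        subst Cat_comp_restrict[OF is_functor_id[OF is_functorD(1)[OF G]]])
      (auto intro!: restrict_func_cong)
  show "Ide Cat (Cod Cat \<Phi>) \<cdot>\<^bsub>Cat\<^esub> \<Phi> = \<Phi>"
    by (subst (2 3) \<Phi>, unfold Cat_Ide, subst Cat_comp_restrict[OF G])
      (auto intro!: restrict_func_cong)
next
  fix A :: "('a, 'b) cat"
  assume "A \<in> Obj Cat"
  then have "is_category A" by (simp add: Cat_def)
  then show "Ide Cat A \<in> Hom Cat A A" unfolding Cat_Ide by (intro Cat_HomI is_functor_id)
next
  fix A B D :: "('a, 'b) cat" and \<Phi> \<Psi>
  assume "\<Phi> \<in> Hom Cat A B" "\<Psi> \<in> Hom Cat B D"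
  then show "\<Psi> \<cdot>\<^bsub>Cat\<^esub> \<Phi> \<in> Hom Cat A D"
    by (elim Cat_HomE) (simp add: Cat_comp_restrict Cat_HomI is_functor_comp)
next
  fix A B D E :: "('a, 'b) cat" and \<Phi> \<Psi> \<Theta>
  assume "\<Phi> \<in> Hom Cat A B" "\<Psi> \<in> Hom Cat B D" "\<Theta> \<in> Hom Cat D E"
  then obtain F G H where F: "is_functor A B F" "\<Phi> = (A, restrict_func A F, B)"
    and G: "is_functor B D G" "\<Psi> = (B, restrict_func B G, D)"
    and H: "\<Theta> = (D, restrict_func D H, E)"
    by (elim Cat_HomE)
  show "(\<Theta> \<cdot>\<^bsub>Cat\<^esub> \<Psi>) \<cdot>\<^bsub>Cat\<^esub> \<Phi> = \<Theta> \<cdot>\<^bsub>Cat\<^esub> (\<Psi> \<cdot>\<^bsub>Cat\<^esub> \<Phi>)"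
    using F(1) G(1) is_functor_comp[OF F(1) G(1)]
    by (simp add: F(2) G(2) H Cat_comp_restrict) (simp add: comp_func_def)
qed

text \<open>The inverse bijections form a functor: \<open>G\<close> preserves endpoints, identities
  and composites, and its injectivity carries this over to the inverse. Invertibility of the
  components of the duality is thereby reduced to two bijections.\<close>

lemma is_iso_CatI:
  assumes G: "is_functor A B G"
    and obj: "bij_betw (FObj G) (Obj A) (Obj B)" and arr: "bij_betw (FArr G) (Arr A) (Arr B)"
  shows "is_iso Cat (A, restrict_func A G, B)"
proof -
  interpret A: category A by unfold_locales (rule is_functorD(1)[OF G])
  interpret B: category B by unfold_locales (rule is_functorD(2)[OF G])
  define P where "P = inv_into (Obj A) (FObj G)"
  define Q where "Q = inv_into (Arr A) (FArr G)"
  define H where "H = \<lparr>FObj = P, FArr = Q\<rparr>"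
  have P: "X \<in> Obj B \<Longrightarrow> P X \<in> Obj A" "X \<in> Obj B \<Longrightarrow> FObj G (P X) = X"
    "Y \<in> Obj A \<Longrightarrow> P (FObj G Y) = Y" for X Y
    unfolding P_def using obj
    by (auto simp: bij_betw_def inv_into_into f_inv_into_f)
  have Q: "f \<in> Arr B \<Longrightarrow> Q f \<in> Arr A" "f \<in> Arr B \<Longrightarrow> FArr G (Q f) = f"
    "g \<in> Arr A \<Longrightarrow> Q (FArr G g) = g" for f g
    unfolding Q_def using arr
    by (auto simp: bij_betw_def inv_into_into f_inv_into_f)
  have QH: "Q f \<in> Hom A (P X) (P Y)" if f: "f \<in> Hom B X Y" for f X Y
  proof -
    note q = Q(1,2)[OF B.homD(1)[OF f]]
    have "FObj G (Dom A (Q f)) = X" "FObj G (Cod A (Q f)) = Y"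
      using B.homD(2,3)[OF is_functorD(4)[OF G q(1)]] q(2) B.homD(2,3)[OF f] by simp_all
    then have "Dom A (Q f) = P X" "Cod A (Q f) = P Y"
      using P(3) A.homD(4,5)[OF A.arr_hom[OF q(1)]] by metis+
    with q(1) show ?thesis by (simp add: Hom_def)
  qed
  have H: "is_functor B A H"
    unfolding is_functor_def
  proof (intro conjI ballI allI)
    show "FArr H (Ide B X) = Ide A (FObj H X)" if "X \<in> Obj B" for X
      using is_functorD(6)[OF G P(1)[OF that]] P(2)[OF that]
        Q(3)[OF A.homD(1)[OF A.ide_hom[OF P(1)[OF that]]]]
      by (simp add: H_def)
    show "FArr H (g \<cdot>\<^bsub>B\<^esub> f) = FArr H g \<cdot>\<^bsub>A\<^esub> FArr H f"
      if f: "f \<in> Hom B X Y" and g: "g \<in> Hom B Y Z" for X Y Z f g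
      using is_functorD(7)[OF G QH[OF f] QH[OF g]] Q(2)[OF B.homD(1)[OF f]]
        Q(2)[OF B.homD(1)[OF g]] Q(3)[OF A.homD(1)[OF A.comp_hom[OF QH[OF f] QH[OF g]]]]
      by (simp add: H_def)
  qed (use P(1) QH B.arr_hom A.is_category B.is_category in \<open>auto simp: H_def\<close>)
  have "(B, restrict_func B H, A) \<cdot>\<^bsub>Cat\<^esub> (A, restrict_func A G, B) = Ide Cat A"
    unfolding Cat_comp_restrict[OF G] Cat_Ide
    using P Q by (auto simp: H_def intro!: restrict_func_cong)
  moreover have "(A, restrict_func A G, B) \<cdot>\<^bsub>Cat\<^esub> (B, restrict_func B H, A) = Ide Cat B"
    unfolding Cat_comp_restrict[OF H] Cat_Ide
    using P Q by (auto simp: H_def intro!: restrict_func_cong)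
  ultimately show ?thesis
    unfolding is_iso_def using Cat_HomI[OF G] Cat_HomI[OF H] by (auto simp: Hom_def)
qed

section \<open>Opposite categories and the duality functor\<close>

lemma op_cat_simps [simp]:
  "Obj (op_cat A) = Obj A" "Arr (op_cat A) = Arr A" "Dom (op_cat A) = Cod A"
  "Cod (op_cat A) = Dom A" "Ide (op_cat A) = Ide A" "g \<cdot>\<^bsub>op_cat A\<^esub> f = f \<cdot>\<^bsub>A\<^esub> g"
  by (simp_all add: op_cat_def)

lemma Hom_op_cat [simp]: "Hom (op_cat A) X Y = Hom A Y X"
  by (auto simp: Hom_def)

lemma is_category_op_cat:
  assumes "is_category A"
  shows "is_category (op_cat A)"
proof -
  interpret category A by unfold_locales (rule assms)
  show ?thesis
    unfolding is_category_def
    using homD(4,5)[OF arr_hom] ide_hom comp_hom comp_ide[OF arr_hom]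
    by (auto simp: assoc)
qed

lemma is_functor_op_cat: "is_functor A B G \<Longrightarrow> is_functor (op_cat A) (op_cat B) G"
  unfolding is_functor_def by (simp add: is_category_op_cat)

text \<open>A category and its opposite have the same carriers, so restricting to either is the
  same.\<close>

lemma op_functor_restrict:
  "FArr op_functor (A, restrict_func A G, B) = (op_cat A, restrict_func (op_cat A) G, op_cat B)"
  by (simp add: op_functor_def restrict_func_def)

lemma is_functor_op_functor: "is_functor Cat Cat op_functor"
  unfolding is_functor_def
proof (intro conjI ballI allI)
  show "FObj op_functor A \<in> Obj Cat" if "A \<in> Obj Cat" for A :: "('a, 'b) cat"
    using that is_category_op_cat by (simp add: Cat_def op_functor_def)
  show "FArr op_functor (Ide Cat A) = Ide Cat (FObj op_functor A)" for A :: "('a, 'b) cat"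
    by (simp add: Cat_Ide op_functor_restrict) (simp add: op_functor_def)
next
  fix \<Phi> assume "\<Phi> \<in> Arr Cat"
  then have "\<Phi> \<in> Hom Cat (Dom Cat \<Phi>) (Cod Cat \<Phi>)" by (simp add: Hom_def)
  then obtain G where \<Phi>: "\<Phi> = (Dom Cat \<Phi>, restrict_func (Dom Cat \<Phi>) G, Cod Cat \<Phi>)"
    and G: "is_functor (Dom Cat \<Phi>) (Cod Cat \<Phi>) G"
    by (rule Cat_HomE)
  show "FArr op_functor \<Phi> \<in> Hom Cat (FObj op_functor (Dom Cat \<Phi>)) (FObj op_functor (Cod Cat \<Phi>))"
    by (subst \<Phi>, unfold op_functor_restrict)
      (simp add: op_functor_def Cat_HomI is_functor_op_cat[OF G])
next
  fix A B D :: "('a, 'b) cat" and \<Phi> \<Psi>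
  assume "\<Phi> \<in> Hom Cat A B" "\<Psi> \<in> Hom Cat B D"
  then obtain F G where F: "is_functor A B F" "\<Phi> = (A, restrict_func A F, B)"
    and G: "\<Psi> = (B, restrict_func B G, D)"
    by (elim Cat_HomE)
  show "FArr op_functor (\<Psi> \<cdot>\<^bsub>Cat\<^esub> \<Phi>) = FArr op_functor \<Psi> \<cdot>\<^bsub>Cat\<^esub> FArr op_functor \<Phi>"
    using F(1) is_functor_op_cat[OF F(1)]
    by (simp add: F(2) G Cat_comp_restrict op_functor_restrict)
qed (rule is_category_Cat)+


section \<open>The underlying functors\<close>

context fact_system
begin

lemma underlying_Obj [simp]: "Obj (underlying_cat C T F X) = Hom C T X"
  and underlying_Dom [simp]: "Dom (underlying_cat C T F X) (x, \<alpha>, y) = x"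
  and underlying_Cod [simp]: "Cod (underlying_cat C T F X) (x, \<alpha>, y) = y"
  and underlying_Ide [simp]: "Ide (underlying_cat C T F X) x = (x, LFac F x, x)"
  and underlying_Comp [simp]: "(y, \<beta>, z) \<cdot>\<^bsub>underlying_cat C T F X\<^esub> (x, \<alpha>, y') =
    (x, hat C F y \<beta> z \<cdot> \<alpha>, z)"
  by (simp_all add: underlying_cat_def)

lemma underlying_Arr [simp]:
  "(x, \<alpha>, y) \<in> Arr (underlying_cat C T F X) \<longleftrightarrow> x \<in> Hom C T X \<and> y \<in> Hom C T X \<and>
     \<alpha> \<in> Hom C T (slice C F y) \<and> RFac F y \<cdot> \<alpha> = x"
  by (simp add: underlying_cat_def)

lemma underlying_Hom_iff:
  "a \<in> Hom (underlying_cat C T F X) x y \<longleftrightarrow>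
    (\<exists>\<alpha>. a = (x, \<alpha>, y) \<and> (x, \<alpha>, y) \<in> Arr (underlying_cat C T F X))"
  by (cases a) (auto simp: Hom_def)

lemma hat_ide:
  assumes "x \<in> Hom C T X"
  shows "hat C F x (LFac F x) x = Ide C (slice C F x)"
proof -
  note x = fac[OF assms] note h = hat[OF assms assms x(3,5)]
  show ?thesis
    using slice_ext[OF assms assms h(1) ide_hom[OF homD(5)[OF x(3)]]] h(2,3) comp_ide[OF x(3)]
      comp_ide[OF x(4)]
    by simp
qed

text \<open>For the last equation, both sides are maps over \<open>X\<close> with the same value on
  \<open>e\<^sub>x\<close>, so \<open>slice_ext\<close> applies. Associativity in
  \<open>underlying_cat\<close> rests on it.\<close>

lemma hat_comp:
  assumes a: "(x, \<alpha>, y) \<in> Arr (underlying_cat C T F X)"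
    and b: "(y, \<beta>, z) \<in> Arr (underlying_cat C T F X)"
  shows "RFac F z \<cdot> (hat C F y \<beta> z \<cdot> \<alpha>) = x"
    "hat C F y \<beta> z \<cdot> \<alpha> \<in> Hom C T (slice C F z)"
    "hat C F x (hat C F y \<beta> z \<cdot> \<alpha>) z = hat C F y \<beta> z \<cdot> hat C F x \<alpha> y"
proof -
  have x: "x \<in> Hom C T X" and y: "y \<in> Hom C T X" and z: "z \<in> Hom C T X"
    and \<alpha>: "\<alpha> \<in> Hom C T (slice C F y)" "RFac F y \<cdot> \<alpha> = x"
    and \<beta>: "\<beta> \<in> Hom C T (slice C F z)" "RFac F z \<cdot> \<beta> = y"
    using a b by auto
  note ha = hat[OF x y \<alpha>] and hb = hat[OF y z \<beta>]
  show 1: "RFac F z \<cdot> (hat C F y \<beta> z \<cdot> \<alpha>) = x"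
    using assoc[OF \<alpha>(1) hb(1) fac(4)[OF z]] hb(2) \<alpha>(2) by simp
  show 2: "hat C F y \<beta> z \<cdot> \<alpha> \<in> Hom C T (slice C F z)"
    using comp_hom[OF \<alpha>(1) hb(1)] .
  note hc = hat[OF x z 2 1]
  show "hat C F x (hat C F y \<beta> z \<cdot> \<alpha>) z = hat C F y \<beta> z \<cdot> hat C F x \<alpha> y"
    by (rule slice_ext[OF x z hc(1) comp_hom[OF ha(1) hb(1)]])
      (use assoc[OF fac(3)[OF x] ha(1) hb(1)] assoc[OF ha(1) hb(1) fac(4)[OF z]]
        ha(2,3) hb(2) hc(2,3) in simp_all)
qed

lemma is_category_underlying_cat: "is_category (underlying_cat C T F X)"
  unfolding is_category_def
proof (intro conjI ballI allI)
  fix a assume "a \<in> Arr (underlying_cat C T F X)"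
  then obtain x \<alpha> y where a: "a = (x, \<alpha>, y)" "(x, \<alpha>, y) \<in> Arr (underlying_cat C T F X)"
    by (cases a) auto
  then have x: "x \<in> Hom C T X" and y: "y \<in> Hom C T X"
    and \<alpha>: "\<alpha> \<in> Hom C T (slice C F y)" "RFac F y \<cdot> \<alpha> = x" by auto
  show "Dom (underlying_cat C T F X) a \<in> Obj (underlying_cat C T F X)"
    "Cod (underlying_cat C T F X) a \<in> Obj (underlying_cat C T F X)"
    using a(1) x y by simp_all
  show "a \<cdot>\<^bsub>underlying_cat C T F X\<^esub> Ide (underlying_cat C T F X) (Dom (underlying_cat C T F X) a) = a"
    using a(1) hat(3)[OF x y \<alpha>] by simp
  show "Ide (underlying_cat C T F X) (Cod (underlying_cat C T F X) a) \<cdot>\<^bsub>underlying_cat C T F X\<^esub> a = a"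
    using a(1) hat_ide[OF y] comp_ide[OF \<alpha>(1)] by simp
next
  fix x assume "x \<in> Obj (underlying_cat C T F X)"
  then show "Ide (underlying_cat C T F X) x \<in> Hom (underlying_cat C T F X) x x"
    using fac unfolding underlying_Hom_iff by auto
next
  fix x y z a b
  assume "a \<in> Hom (underlying_cat C T F X) x y" "b \<in> Hom (underlying_cat C T F X) y z"
  then show "b \<cdot>\<^bsub>underlying_cat C T F X\<^esub> a \<in> Hom (underlying_cat C T F X) x z"
    unfolding underlying_Hom_iff using hat_comp(1,2) by fastforce
next
  fix x y z w a b c
  assume "a \<in> Hom (underlying_cat C T F X) x y" "b \<in> Hom (underlying_cat C T F X) y z"
    "c \<in> Hom (underlying_cat C T F X) z w"
  then obtain \<alpha> \<beta> \<gamma> where a: "a = (x, \<alpha>, y)" "(x, \<alpha>, y) \<in> Arr (underlying_cat C T F X)"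
    and b: "b = (y, \<beta>, z)" "(y, \<beta>, z) \<in> Arr (underlying_cat C T F X)"
    and c: "c = (z, \<gamma>, w)" "(z, \<gamma>, w) \<in> Arr (underlying_cat C T F X)"
    unfolding underlying_Hom_iff by blast
  have "\<alpha> \<in> Hom C T (slice C F y)" "hat C F y \<beta> z \<in> Hom C (slice C F y) (slice C F z)"
    "hat C F z \<gamma> w \<in> Hom C (slice C F z) (slice C F w)"
    using a(2) b(2) c(2) hat(1) by auto
  then show "(c \<cdot>\<^bsub>underlying_cat C T F X\<^esub> b) \<cdot>\<^bsub>underlying_cat C T F X\<^esub> a =
      c \<cdot>\<^bsub>underlying_cat C T F X\<^esub> (b \<cdot>\<^bsub>underlying_cat C T F X\<^esub> a)"
    using hat_comp(3)[OF b(2) c(2)] by (simp add: a(1) b(1) c(1) assoc)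
qed

section \<open>The action of maps on underlying categories\<close>

lemma slice_map_ide:
  assumes "x \<in> Hom C T X"
  shows "slice_map C F (Ide C X) x = Ide C (slice C F x)"
proof -
  note x = fac[OF assms] and s = slice_map[OF assms ide_hom[OF homD(5)[OF assms]]]
  show ?thesis
    using slice_ext[OF assms assms _ ide_hom[OF homD(5)[OF x(3)]]] s comp_ide[OF x(3)]
      comp_ide[OF x(4)] comp_ide[OF assms]
    by simp
qed

lemma slice_map_comp:
  assumes x: "x \<in> Hom C T X" and f: "f \<in> Hom C X Y" and g: "g \<in> Hom C Y Z"
  shows "slice_map C F (g \<cdot> f) x = slice_map C F g (f \<cdot> x) \<cdot> slice_map C F f x"
proof -
  have fx: "f \<cdot> x \<in> Hom C T Y" using comp_hom[OF x f] .
  have gfx: "g \<cdot> (f \<cdot> x) \<in> Hom C T Z" using comp_hom[OF fx g] .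
  \<comment> \<open>The unfolding moves brackets so that \<open>s\<close> ends in the slice at
    \<open>g \<cdot> (f \<cdot> x)\<close>, where the composite of the two slice maps ends as
    well.\<close>
  note sf = slice_map[OF x f] and sg = slice_map[OF fx g]
    and s = slice_map[OF x comp_hom[OF f g], unfolded assoc[OF x f g]]
  show ?thesis
  proof (rule slice_ext[OF x gfx s(1) comp_hom[OF sf(1) sg(1)]])
    show "slice_map C F (g \<cdot> f) x \<cdot> LFac F x =
        slice_map C F g (f \<cdot> x) \<cdot> slice_map C F f x \<cdot> LFac F x"
      using assoc[OF fac(3)[OF x] sf(1) sg(1)] s(3) sf(3) sg(3) by simp
    show "RFac F (g \<cdot> (f \<cdot> x)) \<cdot> slice_map C F (g \<cdot> f) x =
        RFac F (g \<cdot> (f \<cdot> x)) \<cdot> (slice_map C F g (f \<cdot> x) \<cdot> slice_map C F f x)"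
      using assoc[OF sf(1) sg(1) fac(4)[OF gfx]] assoc[OF sf(1) fac(4)[OF fx] g]
        assoc[OF fac(4)[OF x] f g] s(2) sf(2) sg(2) by simp
  qed
qed

text \<open>Both sides of the first equation lie over \<open>f\<close> and have the value
  \<open>slice_map C F f z \<cdot> \<beta>\<close> on \<open>e\<^sub>y\<close>. This compatibility
  with hats is what makes \<open>underlying_map\<close> preserve composites.\<close>

lemma slice_map_hat:
  assumes b: "(y, \<beta>, z) \<in> Arr (underlying_cat C T F X)" and f: "f \<in> Hom C X Y"
  shows "slice_map C F f z \<cdot> hat C F y \<beta> z =
    hat C F (f \<cdot> y) (slice_map C F f z \<cdot> \<beta>) (f \<cdot> z) \<cdot> slice_map C F f y"
    "RFac F (f \<cdot> z) \<cdot> (slice_map C F f z \<cdot> \<beta>) = f \<cdot> y"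
proof -
  have y: "y \<in> Hom C T X" and z: "z \<in> Hom C T X"
    and \<beta>: "\<beta> \<in> Hom C T (slice C F z)" "RFac F z \<cdot> \<beta> = y"
    using b by auto
  have fy: "f \<cdot> y \<in> Hom C T Y" and fz: "f \<cdot> z \<in> Hom C T Y"
    using comp_hom[OF y f] comp_hom[OF z f] .
  note hb = hat[OF y z \<beta>] and sy = slice_map[OF y f] and sz = slice_map[OF z f]
  show 2: "RFac F (f \<cdot> z) \<cdot> (slice_map C F f z \<cdot> \<beta>) = f \<cdot> y"
    using assoc[OF \<beta>(1) sz(1) fac(4)[OF fz]] assoc[OF \<beta>(1) fac(4)[OF z] f] sz(2) \<beta>(2) by simp
  note h = hat[OF fy fz comp_hom[OF \<beta>(1) sz(1)] 2]
  show "slice_map C F f z \<cdot> hat C F y \<beta> z =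
    hat C F (f \<cdot> y) (slice_map C F f z \<cdot> \<beta>) (f \<cdot> z) \<cdot> slice_map C F f y" (is "?l = ?r")
  proof (rule slice_ext[OF y fz comp_hom[OF hb(1) sz(1)] comp_hom[OF sy(1) h(1)]])
    show "?l \<cdot> LFac F y = ?r \<cdot> LFac F y"
      using assoc[OF fac(3)[OF y] hb(1) sz(1)] assoc[OF fac(3)[OF y] sy(1) h(1)]
        hb(3) sy(3) h(3) by simp
    show "RFac F (f \<cdot> z) \<cdot> ?l = RFac F (f \<cdot> z) \<cdot> ?r"
      using assoc[OF hb(1) sz(1) fac(4)[OF fz]] assoc[OF sy(1) h(1) fac(4)[OF fz]]
        assoc[OF hb(1) fac(4)[OF z] f] hb(2) sz(2) sy(2) h(2) by simp
  qed
qed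

lemma is_functor_underlying_map:
  assumes f: "f \<in> Hom C X Y"
  shows "is_functor (underlying_cat C T F X) (underlying_cat C T F Y) (underlying_map C F f)"
  unfolding is_functor_def
proof (intro conjI ballI allI)
  fix a assume "a \<in> Arr (underlying_cat C T F X)"
  then obtain x \<alpha> y where a: "a = (x, \<alpha>, y)" "(x, \<alpha>, y) \<in> Arr (underlying_cat C T F X)"
    by (cases a) auto
  then show "FArr (underlying_map C F f) a \<in> Hom (underlying_cat C T F Y)
      (FObj (underlying_map C F f) (Dom (underlying_cat C T F X) a))
      (FObj (underlying_map C F f) (Cod (underlying_cat C T F X) a))"
    using slice_map_hat(2)[OF a(2) f] comp_hom[OF _ f] slice_map(1)[OF _ f] comp_hom
    by (auto simp: underlying_map_def underlying_Hom_iff)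
next
  fix x y z a b
  assume "a \<in> Hom (underlying_cat C T F X) x y" "b \<in> Hom (underlying_cat C T F X) y z"
  then obtain \<alpha> \<beta> where a: "a = (x, \<alpha>, y)" "(x, \<alpha>, y) \<in> Arr (underlying_cat C T F X)"
    and b: "b = (y, \<beta>, z)" "(y, \<beta>, z) \<in> Arr (underlying_cat C T F X)"
    unfolding underlying_Hom_iff by blast
  have y: "y \<in> Hom C T X" and z: "z \<in> Hom C T X" and \<alpha>: "\<alpha> \<in> Hom C T (slice C F y)"
    and \<beta>: "\<beta> \<in> Hom C T (slice C F z)" "RFac F z \<cdot> \<beta> = y"
    using a(2) b(2) by auto
  note s = slice_map_hat[OF b(2) f] and sy = slice_map(1)[OF y f] and sz = slice_map(1)[OF z f]
  note h = hat(1)[OF comp_hom[OF y f] comp_hom[OF z f] comp_hom[OF \<beta>(1) sz] s(2)]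
  show "FArr (underlying_map C F f) (b \<cdot>\<^bsub>underlying_cat C T F X\<^esub> a) =
      FArr (underlying_map C F f) b \<cdot>\<^bsub>underlying_cat C T F Y\<^esub> FArr (underlying_map C F f) a"
    using assoc[OF \<alpha> hat(1)[OF y z \<beta>] sz] assoc[OF \<alpha> sy h] s(1)
    by (simp add: a(1) b(1) underlying_map_def)
qed (use f comp_hom slice_map(3) in
    \<open>auto simp: is_category_underlying_cat underlying_map_def\<close>)

lemma underlying_functor_simps:
  "FObj (underlying_functor C T F) X = underlying_cat C T F X"
  "f \<in> Hom C X Y \<Longrightarrow> FArr (underlying_functor C T F) f =
    (underlying_cat C T F X, restrict_func (underlying_cat C T F X) (underlying_map C F f),
     underlying_cat C T F Y)"
  by (simp_all add: underlying_functor_def Hom_def Let_def)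

lemma is_functor_underlying_functor: "is_functor C Cat (underlying_functor C T F)"
  unfolding is_functor_def
proof (intro conjI ballI allI)
  show "FArr (underlying_functor C T F) f \<in> Hom Cat (FObj (underlying_functor C T F) (Dom C f))
      (FObj (underlying_functor C T F) (Cod C f))" if "f \<in> Arr C" for f
    using arr_hom[OF that] Cat_HomI[OF is_functor_underlying_map]
    by (simp add: underlying_functor_simps)
  show "FArr (underlying_functor C T F) (Ide C X) = Ide Cat (FObj (underlying_functor C T F) X)"
    if "X \<in> Obj C" for X
    using ide_hom[OF that] comp_ide slice_map_ide
    by (auto simp: underlying_functor_simps Cat_Ide underlying_map_def intro!: restrict_func_cong)
next
  fix X Y Z f g assume f: "f \<in> Hom C X Y" and g: "g \<in> Hom C Y Z"
  have "slice_map C F (g \<cdot> f) y \<cdot> \<alpha> = slice_map C F g (f \<cdot> y) \<cdot> (slice_map C F f y \<cdot> \<alpha>)"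
    if "y \<in> Hom C T X" "\<alpha> \<in> Hom C T (slice C F y)" for y \<alpha>
    using slice_map_comp[OF that(1) f g] slice_map(1)[OF that(1) f]
      slice_map(1)[OF comp_hom[OF that(1) f] g] assoc that(2)
    by simp
  then show "FArr (underlying_functor C T F) (g \<cdot> f) =
      FArr (underlying_functor C T F) g \<cdot>\<^bsub>Cat\<^esub> FArr (underlying_functor C T F) f"
    using assoc[OF _ f g]
    unfolding underlying_functor_simps(2)[OF f] underlying_functor_simps(2)[OF g]
      underlying_functor_simps(2)[OF comp_hom[OF f g]]
      Cat_comp_restrict[OF is_functor_underlying_map[OF f]]
    by (auto simp: underlying_map_def intro!: restrict_func_cong)
qed (auto simp: is_category is_category_Cat underlying_functor_simps is_category_underlying_cat,
    simp add: Cat_def is_category_underlying_cat)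

end

section \<open>Duality\<close>

text \<open>The condition amounts to equality of the images in the reflection of \<open>K\<close>
  into \<M>/1; testing against all objects of \<M>/1 expresses it without choosing a
  reflection.\<close>

definition connected :: "('o, 'a) cat \<Rightarrow> 'o \<Rightarrow> 'a fact_sys \<Rightarrow> 'o \<Rightarrow> 'a \<Rightarrow> 'a \<Rightarrow> bool" where
  "connected C T F K w w' \<longleftrightarrow>
     (\<forall>S. \<forall>t \<in> Hom C S T. t \<in> RCls F \<longrightarrow> (\<forall>k \<in> Hom C K S. k \<cdot>\<^bsub>C\<^esub> w = k \<cdot>\<^bsub>C\<^esub> w'))"

lemma connected_refl: "connected C T F K w w"
  and connected_sym: "connected C T F K w w' \<Longrightarrow> connected C T F K w' w"
  and connected_trans:
    "connected C T F K w w' \<Longrightarrow> connected C T F K w' w'' \<Longrightarrow> connected C T F K w w''"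
  unfolding connected_def by auto

text \<open>Fixing one pullback for each cospan makes \<open>linked\<close> speak of the points of a
  single object; for \<open>\<up>x\<close> and \<open>\<down>y\<close> this object is
  \<open>[x, y]\<close>.\<close>

definition chosen_pullback :: "('o, 'a) cat \<Rightarrow> 'a \<Rightarrow> 'a \<Rightarrow> 'a \<times> 'a" where
  "chosen_pullback C m n = (SOME pq. is_pullback C (fst pq) (snd pq) m n)"

text \<open>Points of the pullback are named by their pairs of components. The relation thus lives
  on pairs, and maps of cospans act on it componentwise.\<close>

definition linked ::
    "('o, 'a) cat \<Rightarrow> 'o \<Rightarrow> 'a fact_sys \<Rightarrow> 'a \<Rightarrow> 'a \<Rightarrow> 'a \<times> 'a \<Rightarrow> 'a \<times> 'a \<Rightarrow> bool" where
  "linked C T F m n a b \<longleftrightarrow> (let (p, q) = chosen_pullback C m n in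
     \<exists>w \<in> Hom C T (Dom C p). \<exists>w' \<in> Hom C T (Dom C p).
       (p \<cdot>\<^bsub>C\<^esub> w, q \<cdot>\<^bsub>C\<^esub> w) = a \<and> (p \<cdot>\<^bsub>C\<^esub> w', q \<cdot>\<^bsub>C\<^esub> w') = b \<and> connected C T F (Dom C p) w w')"

definition dual_arr ::
    "('o, 'a) cat \<Rightarrow> 'o \<Rightarrow> 'a fact_sys \<Rightarrow> 'a fact_sys \<Rightarrow> 'a \<Rightarrow> 'a \<Rightarrow> 'a \<Rightarrow> 'a \<Rightarrow> bool"
  where
  "dual_arr C T F F' x y \<alpha> \<alpha>' \<longleftrightarrow>
     linked C T F (RFac F' x) (RFac F y) (LFac F' x, \<alpha>) (\<alpha>', LFac F y)"

text \<open>The direction is from right to left, as the isomorphism starts at the right underlying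
  functor. The triple is reversed: \<open>(x, \<alpha>, y)\<close> counts as an arrow from
  \<open>y\<close> to \<open>x\<close> of the opposite category. The description is justified by
  \<open>dual_arr_ex1_left\<close>.\<close>

definition dual_map ::
    "('o, 'a) cat \<Rightarrow> 'o \<Rightarrow> 'a fact_sys \<Rightarrow> 'a fact_sys \<Rightarrow> 'o
     \<Rightarrow> ('a, 'a \<times> 'a \<times> 'a, 'a, 'a \<times> 'a \<times> 'a) func" where
  "dual_map C T F F' X = \<lparr>FObj = (\<lambda>x. x),
     FArr = (\<lambda>(y, \<alpha>', x). (x, THE \<alpha>. (x, \<alpha>, y) \<in> Arr (underlying_cat C T F X) \<and>
       dual_arr C T F F' x y \<alpha> \<alpha>', y))\<rparr>"

section \<open>Balanced factorization categories\<close>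

locale balanced = category +
  fixes T :: 'o and F F' :: "'a fact_sys"
  assumes balanced: "balanced_factorization_category C T F F'"

sublocale balanced \<subseteq> L: fact_system C F
  using balanced by unfold_locales (simp add: balanced_factorization_category_def)

sublocale balanced \<subseteq> R: fact_system C F'
  using balanced by unfold_locales (simp add: balanced_factorization_category_def)

context balanced
begin

text \<open>The axioms are symmetric in the two systems; this transfers the result on fibres over
  \<open>e\<^sub>y\<close> to those over \<open>i\<^sub>x\<close>.\<close>

lemma swap: "balanced C T F' F"
  using balanced by unfold_locales (simp add: balanced_factorization_category_def)

lemma RCls_eq: "t \<in> Hom C S T \<Longrightarrow> t \<in> RCls F \<longleftrightarrow> t \<in> RCls F'"
  using balanced homD(4)[of t S T] unfolding balanced_factorization_category_def by blast

text \<open>The tests involve a right class only through its maps to \<open>T\<close>, which both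
  systems share.\<close>

lemma connected_swap: "connected C T F' = connected C T F"
  unfolding connected_def using RCls_eq by (intro ext) blast

lemma LCls_pullback:
  "e \<in> LCls F \<Longrightarrow> m \<in> RCls F' \<Longrightarrow> is_pullback C p q m e \<Longrightarrow> p \<in> LCls F"
  using balanced unfolding balanced_factorization_category_def by blast

lemma terminal: "X \<in> Obj C \<Longrightarrow> \<exists>!t. t \<in> Hom C X T"
  using balanced unfolding balanced_factorization_category_def is_terminal_def by blast

lemma terminal_eq: "s \<in> Hom C X T \<Longrightarrow> t \<in> Hom C X T \<Longrightarrow> s = t"
  using terminal homD(4) by blast

lemma T_obj: "T \<in> Obj C"
  using balanced unfolding balanced_factorization_category_def is_terminal_def by blast

lemma pullback_ex: "m \<in> Hom C A X \<Longrightarrow> n \<in> Hom C B X \<Longrightarrow> \<exists>p q. is_pullback C p q m n"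
  using ex_pullback balanced unfolding balanced_factorization_category_def by blast

lemma chosen_pullback:
  assumes "m \<in> Hom C A X" "n \<in> Hom C B X"
  obtains p q where "chosen_pullback C m n = (p, q)" "is_pullback C p q m n"
    "p \<in> Hom C (Dom C p) A" "q \<in> Hom C (Dom C p) B"
proof -
  have "\<exists>pq. is_pullback C (fst pq) (snd pq) m n" using pullback_ex[OF assms] by simp
  then have "is_pullback C (fst (chosen_pullback C m n)) (snd (chosen_pullback C m n)) m n"
    unfolding chosen_pullback_def by (rule someI_ex)
  moreover from this have "fst (chosen_pullback C m n) \<in> Hom C (Dom C (fst (chosen_pullback C m n))) A"
    "snd (chosen_pullback C m n) \<in> Hom C (Dom C (fst (chosen_pullback C m n))) B"
    using pullback_homs(1,2) homD(2)[OF assms(1)] homD(2)[OF assms(2)] by metis+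
  ultimately show thesis using that[of "fst (chosen_pullback C m n)" "snd (chosen_pullback C m n)"]
    by simp
qed

section \<open>Connected points and fibres\<close>

lemma connected_map:
  assumes w: "w \<in> Hom C T K" "w' \<in> Hom C T K" and h: "h \<in> Hom C K K'"
    and c: "connected C T F K w w'"
  shows "connected C T F K' (h \<cdot> w) (h \<cdot> w')"
  unfolding connected_def
proof (intro ballI allI impI)
  fix S t k assume t: "t \<in> Hom C S T" "t \<in> RCls F" and k: "k \<in> Hom C K' S"
  have "(k \<cdot> h) \<cdot> w = (k \<cdot> h) \<cdot> w'"
    using c t comp_hom[OF h k] unfolding connected_def by blast
  then show "k \<cdot> (h \<cdot> w) = k \<cdot> (h \<cdot> w')"
    using assoc[OF w(1) h k] assoc[OF w(2) h k] by simp
qed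

text \<open>The fibre of \<open>q\<close> over \<open>e\<close> is the reflection of \<open>K\<close> into the objects that lie over \<open>1\<close> by
  a map in \<open>\<M>\<close>: its inclusion is in \<open>\<E>\<close> by balance, and it lies in \<open>\<M>'/1 = \<M>/1\<close>.\<close>

lemma connected_fibre_ex1:
  assumes q: "q \<in> RCls F'" "q \<in> Hom C K A" and e: "e \<in> LCls F" "e \<in> Hom C T A"
    and w: "w \<in> Hom C T K"
  shows "\<exists>!w'. w' \<in> Hom C T K \<and> q \<cdot> w' = e \<and> connected C T F K w w'"
proof -
  obtain d t where pb: "is_pullback C d t q e" using pullback_ex[OF q(2) e(2)] by blast
  define P where "P = Dom C d"
  have d: "d \<in> Hom C P K" and t: "t \<in> Hom C P T" and qd: "q \<cdot> d = e \<cdot> t"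
    using pullback_homs(1,2,5)[OF pb] homD(2)[OF q(2)] homD(2)[OF e(2)] by (auto simp: P_def)
  have dL: "d \<in> LCls F" using LCls_pullback[OF e(1) q(1) pb] .
  have tR: "t \<in> RCls F" using R.RCls_pullback[OF pb q(1)] RCls_eq[OF t] by blast
  have P: "P \<in> Obj C" using homD(4)[OF d] .
  obtain s where s: "s \<in> Hom C K T" using terminal[OF homD(5)[OF d]] by blast
  \<comment> \<open>A square from \<open>d\<close> in \<E> to \<open>t\<close> in \<M>, commuting
    because \<open>T\<close> is terminal. Its diagonal is the reflection \<open>r\<close> of
    \<open>K\<close> onto the fibre \<open>P\<close>, with section \<open>d\<close>.\<close>
  have "t \<cdot> Ide C P = s \<cdot> d" using terminal_eq[OF comp_hom[OF ide_hom[OF P] t] comp_hom[OF d s]] .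
  then obtain r where r: "r \<in> Hom C K P" "r \<cdot> d = Ide C P"
    using L.lift_ex1[OF dL tR d t ide_hom[OF P] s] by blast
  have rw: "r \<cdot> w \<in> Hom C T P" using comp_hom[OF w r(1)] .
  have "q \<cdot> (d \<cdot> (r \<cdot> w)) = e \<cdot> (t \<cdot> (r \<cdot> w))"
    using assoc[OF rw d q(2)] assoc[OF rw t e(2)] qd by simp
  also have "t \<cdot> (r \<cdot> w) = Ide C T"
    using terminal_eq[OF comp_hom[OF rw t] ide_hom[OF T_obj]] .
  finally have 1: "q \<cdot> (d \<cdot> (r \<cdot> w)) = e" using comp_ide[OF e(2)] by simp
  have 2: "connected C T F K w (d \<cdot> (r \<cdot> w))"
    unfolding connected_def
  proof (intro ballI allI impI)
    fix S u k assume u: "u \<in> Hom C S T" "u \<in> RCls F" and k: "k \<in> Hom C K S"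
    have kd: "k \<cdot> d \<in> Hom C P S" using comp_hom[OF d k] .
    have kdr: "(k \<cdot> d) \<cdot> r \<in> Hom C K S" using comp_hom[OF r(1) kd] .
    \<comment> \<open>Every test map factors through \<open>r\<close>: the two sides agree on
      \<open>d\<close> in \<E> and over 1. Hence no test separates \<open>w\<close> from
      \<open>d \<cdot> (r \<cdot> w)\<close>.\<close>
    have "k = (k \<cdot> d) \<cdot> r"
    proof (rule L.lift_ext[OF dL d u(2,1) k kdr])
      show "k \<cdot> d = (k \<cdot> d) \<cdot> r \<cdot> d" using assoc[OF d r(1) kd] r(2) comp_ide[OF kd] by simp
      show "u \<cdot> k = u \<cdot> ((k \<cdot> d) \<cdot> r)"
        using terminal_eq[OF comp_hom[OF k u(1)] comp_hom[OF kdr u(1)]] .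
    qed
    then show "k \<cdot> w = k \<cdot> (d \<cdot> (r \<cdot> w))"
      using assoc[OF w r(1) kd] assoc[OF rw d k] by simp
  qed
  have 3: "w' = d \<cdot> (r \<cdot> w)"
    if w': "w' \<in> Hom C T K" "q \<cdot> w' = e" "connected C T F K w w'" for w'
  proof -
    have "q \<cdot> w' = e \<cdot> Ide C T" using w'(2) comp_ide[OF e(2)] by simp
    then obtain v where v: "v \<in> Hom C T P" "d \<cdot> v = w'"
      using pullback_lift[OF pb, of w' T "Ide C T"] w'(1) ide_hom[OF T_obj] homD(2)[OF q(2)]
        homD(2)[OF e(2)] unfolding P_def by metis
    \<comment> \<open>Here \<open>r\<close> itself is the test map, as its target \<open>P\<close>
      lies in \<M>/1.\<close>
    have "r \<cdot> w = r \<cdot> w'" using w'(3) t tR r(1) unfolding connected_def by blast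
    also have "r \<cdot> w' = v" using assoc[OF v(1) d r(1)] v r(2) comp_ide[OF v(1)] by simp
    finally show ?thesis using v(2) by simp
  qed
  from 1 2 3 comp_hom[OF rw d] show ?thesis by blast
qed

section \<open>Linked points of pullbacks\<close>

lemma linked_iff:
  assumes "chosen_pullback C m n = (p, q)" "is_pullback C p q m n"
    and "w \<in> Hom C T (Dom C p)" "w' \<in> Hom C T (Dom C p)"
  shows "linked C T F m n (p \<cdot> w, q \<cdot> w) (p \<cdot> w', q \<cdot> w') \<longleftrightarrow> connected C T F (Dom C p) w w'"
  \<comment> \<open>Components determine a point of the pullback, so the witnesses in
    \<open>linked\<close> can only be \<open>w\<close> and \<open>w'\<close>.\<close>
  using assms pullback_ext[OF assms(2)] unfolding linked_def by auto metis+

lemma linkedE: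
  assumes "linked C T F m n (u, v) (u', v')" "chosen_pullback C m n = (p, q)"
  obtains w w' where "w \<in> Hom C T (Dom C p)" "w' \<in> Hom C T (Dom C p)"
    "u = p \<cdot> w" "v = q \<cdot> w" "u' = p \<cdot> w'" "v' = q \<cdot> w'" "connected C T F (Dom C p) w w'"
  using assms unfolding linked_def by auto

lemma linked_trans:
  assumes "m \<in> Hom C A X" "n \<in> Hom C B X"
    and "linked C T F m n (u, v) (u', v')" "linked C T F m n (u', v') (u'', v'')"
  shows "linked C T F m n (u, v) (u'', v'')"
proof -
  obtain p q where pq: "chosen_pullback C m n = (p, q)" "is_pullback C p q m n"
    using chosen_pullback[OF assms(1,2)] by blast
  obtain w w' where w: "w \<in> Hom C T (Dom C p)" "w' \<in> Hom C T (Dom C p)"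
    "u = p \<cdot> w" "v = q \<cdot> w" "u' = p \<cdot> w'" "v' = q \<cdot> w'" "connected C T F (Dom C p) w w'"
    using linkedE[OF assms(3) pq(1)] by blast
  obtain z z' where z: "z \<in> Hom C T (Dom C p)" "z' \<in> Hom C T (Dom C p)"
    "u' = p \<cdot> z" "v' = q \<cdot> z" "u'' = p \<cdot> z'" "v'' = q \<cdot> z'" "connected C T F (Dom C p) z z'"
    using linkedE[OF assms(4) pq(1)] by blast
  \<comment> \<open>The middle pair of components names a single point, which joins the two
    connections.\<close>
  have "w' = z" using pullback_ext[OF pq(2) w(2) z(1)] w z by simp
  then show ?thesis
    using linked_iff[OF pq w(1) z(2)] connected_trans[OF w(7)] z w by simp
qed

text \<open>The maps \<open>a\<close>, \<open>b\<close>, \<open>f\<close> form a map of cospans. It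
  induces a map \<open>h\<close> of pullbacks that acts on components by \<open>a\<close> and
  \<open>b\<close>, and \<open>h\<close> preserves connectedness.\<close>

lemma linked_map:
  assumes m: "m \<in> Hom C A X" and n: "n \<in> Hom C B X"
    and m': "m' \<in> Hom C A' X'" and n': "n' \<in> Hom C B' X'"
    and a: "a \<in> Hom C A A'" and b: "b \<in> Hom C B B'" and f: "f \<in> Hom C X X'"
    and eq: "m' \<cdot> a = f \<cdot> m" "n' \<cdot> b = f \<cdot> n"
    and l: "linked C T F m n (u, v) (u', v')"
  shows "linked C T F m' n' (a \<cdot> u, b \<cdot> v) (a \<cdot> u', b \<cdot> v')"
proof -
  obtain p q where pq: "chosen_pullback C m n = (p, q)" "is_pullback C p q m n"
    and p: "p \<in> Hom C (Dom C p) A" and q: "q \<in> Hom C (Dom C p) B"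
    using chosen_pullback[OF m n] by blast
  obtain p' q' where pq': "chosen_pullback C m' n' = (p', q')" "is_pullback C p' q' m' n'"
    and p': "p' \<in> Hom C (Dom C p') A'" and q': "q' \<in> Hom C (Dom C p') B'"
    using chosen_pullback[OF m' n'] by blast
  obtain w w' where w: "w \<in> Hom C T (Dom C p)" "w' \<in> Hom C T (Dom C p)"
    "u = p \<cdot> w" "v = q \<cdot> w" "u' = p \<cdot> w'" "v' = q \<cdot> w'" "connected C T F (Dom C p) w w'"
    using linkedE[OF l pq(1)] by blast
  have "m' \<cdot> (a \<cdot> p) = n' \<cdot> (b \<cdot> q)"
    using assoc[OF p a m'] assoc[OF q b n'] assoc[OF p m f] assoc[OF q n f] eq
      pullback_homs(5)[OF pq(2)] by simp
  then obtain h where h: "h \<in> Hom C (Dom C p) (Dom C p')" "p' \<cdot> h = a \<cdot> p" "q' \<cdot> h = b \<cdot> q"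
    using pullback_lift[OF pq'(2), of "a \<cdot> p" "Dom C p" "b \<cdot> q"] comp_hom[OF p a] comp_hom[OF q b]
      homD(2)[OF m'] homD(2)[OF n'] by metis
  have "a \<cdot> (p \<cdot> z) = p' \<cdot> (h \<cdot> z)" "b \<cdot> (q \<cdot> z) = q' \<cdot> (h \<cdot> z)"
    if z: "z \<in> Hom C T (Dom C p)" for z
    using assoc[OF z p a] assoc[OF z q b] assoc[OF z h(1) p'] assoc[OF z h(1) q'] h(2,3) by simp_all
  then show ?thesis
    using linked_iff[OF pq' comp_hom[OF w(1) h(1)] comp_hom[OF w(2) h(1)]]
      connected_map[OF w(1,2) h(1) w(7)] w(1-6) by simp
qed

text \<open>The leg \<open>q\<close> is a pullback of \<open>m\<close>, hence in
  \<open>\<M>'\<close>, so its fibre over \<open>e\<close> has exactly one point connected to the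
  one named by \<open>(u, v)\<close>. The first component of that point is
  \<open>u'\<close>.\<close>

lemma linked_ex1_left:
  assumes m: "m \<in> RCls F'" "m \<in> Hom C A X" and n: "n \<in> Hom C B X"
    and e: "e \<in> LCls F" "e \<in> Hom C T B"
    and u: "u \<in> Hom C T A" and v: "v \<in> Hom C T B" and eq: "m \<cdot> u = n \<cdot> v"
  shows "\<exists>!u'. u' \<in> Hom C T A \<and> m \<cdot> u' = n \<cdot> e \<and> linked C T F m n (u, v) (u', e)"
proof -
  obtain p q where pq: "chosen_pullback C m n = (p, q)" "is_pullback C p q m n"
    and p: "p \<in> Hom C (Dom C p) A" and q: "q \<in> Hom C (Dom C p) B"
    using chosen_pullback[OF m(2) n] by blast
  obtain w where w: "w \<in> Hom C T (Dom C p)" "p \<cdot> w = u" "q \<cdot> w = v"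
    using pullback_lift[OF pq(2), of u T v] u v eq homD(2)[OF m(2)] homD(2)[OF n] by metis
  have qR: "q \<in> RCls F'" using R.RCls_pullback[OF pq(2) m(1)] .
  have ex1: "\<exists>!w'. w' \<in> Hom C T (Dom C p) \<and> q \<cdot> w' = e \<and> connected C T F (Dom C p) w w'"
    using connected_fibre_ex1[OF qR q e w(1)] .
  then obtain w' where w': "w' \<in> Hom C T (Dom C p)" "q \<cdot> w' = e" "connected C T F (Dom C p) w w'"
    by blast
  have "m \<cdot> (p \<cdot> w') = n \<cdot> e"
    using assoc[OF w'(1) p m(2)] assoc[OF w'(1) q n] pullback_homs(5)[OF pq(2)] w'(2) by simp
  moreover have "linked C T F m n (u, v) (p \<cdot> w', e)"
    using linked_iff[OF pq w(1) w'(1)] w w' by simp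
  moreover have "u' = p \<cdot> w'" if l: "linked C T F m n (u, v) (u', e)" for u'
  proof -
    obtain z z' where z: "z \<in> Hom C T (Dom C p)" "z' \<in> Hom C T (Dom C p)"
      "u = p \<cdot> z" "v = q \<cdot> z" "u' = p \<cdot> z'" "e = q \<cdot> z'" "connected C T F (Dom C p) z z'"
      using linkedE[OF l pq(1)] by blast
    have "w = z" using pullback_ext[OF pq(2) w(1) z(1)] w z by simp
    then have "z' = w'" using ex1 z w' by metis
    then show ?thesis using z by simp
  qed
  ultimately show ?thesis using comp_hom[OF w'(1) p] by blast
qed

text \<open>The mirror image: \<open>pullback_swap\<close> shows that \<open>p\<close> is in \<M>,
  and \<open>swap\<close> gives the fibre result for \<open>p\<close> and \<open>e\<close> in
  \<open>\<E>'\<close>. The point of the fibre now stands first in \<open>linked\<close>, hence the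
  appeals to symmetry.\<close>

lemma linked_ex1_right:
  assumes m: "m \<in> Hom C A X" and n: "n \<in> RCls F" "n \<in> Hom C B X"
    and e: "e \<in> LCls F'" "e \<in> Hom C T A"
    and u: "u \<in> Hom C T A" and v: "v \<in> Hom C T B" and eq: "m \<cdot> u = n \<cdot> v"
  shows "\<exists>!v'. v' \<in> Hom C T B \<and> n \<cdot> v' = m \<cdot> e \<and> linked C T F m n (e, v') (u, v)"
proof -
  obtain p q where pq: "chosen_pullback C m n = (p, q)" "is_pullback C p q m n"
    and p: "p \<in> Hom C (Dom C p) A" and q: "q \<in> Hom C (Dom C p) B"
    using chosen_pullback[OF m n(2)] by blast
  obtain w where w: "w \<in> Hom C T (Dom C p)" "p \<cdot> w = u" "q \<cdot> w = v"
    using pullback_lift[OF pq(2), of u T v] u v eq homD(2)[OF m] homD(2)[OF n(2)] by metis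
  have pR: "p \<in> RCls F" using L.RCls_pullback[OF pullback_swap[OF pq(2)] n(1)] .
  have ex1: "\<exists>!w'. w' \<in> Hom C T (Dom C p) \<and> p \<cdot> w' = e \<and> connected C T F (Dom C p) w w'"
    using balanced.connected_fibre_ex1[OF swap pR p e w(1)] unfolding connected_swap .
  then obtain w' where w': "w' \<in> Hom C T (Dom C p)" "p \<cdot> w' = e" "connected C T F (Dom C p) w w'"
    by blast
  have "n \<cdot> (q \<cdot> w') = m \<cdot> e"
    using assoc[OF w'(1) p m] assoc[OF w'(1) q n(2)] pullback_homs(5)[OF pq(2)] w'(2) by simp
  moreover have "linked C T F m n (e, q \<cdot> w') (u, v)"
    using linked_iff[OF pq w'(1) w(1)] connected_sym[OF w'(3)] w w' by simp
  moreover have "v' = q \<cdot> w'" if l: "linked C T F m n (e, v') (u, v)" for v'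
  proof -
    obtain z' z where z: "z' \<in> Hom C T (Dom C p)" "z \<in> Hom C T (Dom C p)"
      "e = p \<cdot> z'" "v' = q \<cdot> z'" "u = p \<cdot> z" "v = q \<cdot> z" "connected C T F (Dom C p) z' z"
      using linkedE[OF l pq(1)] by blast
    have "w = z" using pullback_ext[OF pq(2) w(1) z(2)] w z by simp
    then have "z' = w'" using ex1 z connected_sym[OF z(7)] w' by metis
    then show ?thesis using z by simp
  qed
  ultimately show ?thesis using comp_hom[OF w'(1) q] by blast
qed

section \<open>The correspondence of left and right arrows\<close>

lemma dual_arr_ex1_right:
  assumes "(x, \<alpha>, y) \<in> Arr (underlying_cat C T F X)"
  shows "\<exists>!\<alpha>'. (y, \<alpha>', x) \<in> Arr (underlying_cat C T F' X) \<and> dual_arr C T F F' x y \<alpha> \<alpha>'"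
proof -
  have x: "x \<in> Hom C T X" and y: "y \<in> Hom C T X"
    and \<alpha>: "\<alpha> \<in> Hom C T (slice C F y)" "RFac F y \<cdot> \<alpha> = x"
    using assms by auto
  note fx = R.fac[OF x] and fy = L.fac[OF y]
  have "RFac F' x \<cdot> LFac F' x = RFac F y \<cdot> \<alpha>" using fx(5) \<alpha>(2) by simp
  \<comment> \<open>The given point of \<open>[x, y]\<close> is \<open>(i\<^sub>x, \<alpha>)\<close>
    and the fibre is the one over \<open>e\<^sub>y\<close>. Since \<open>\<down>y\<close> takes
    \<open>e\<^sub>y\<close> to \<open>y\<close>, the condition on \<open>u'\<close> says that it
    lies over \<open>y\<close>, as an arrow from \<open>y\<close> to \<open>x\<close> must.\<close>
  from linked_ex1_left[OF fx(2,4) fy(4,1,3) fx(3) \<alpha>(1) this]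
  show ?thesis using x y fy(5) by (simp add: dual_arr_def conj_ac)
qed

lemma dual_arr_ex1_left:
  assumes "(y, \<alpha>', x) \<in> Arr (underlying_cat C T F' X)"
  shows "\<exists>!\<alpha>. (x, \<alpha>, y) \<in> Arr (underlying_cat C T F X) \<and> dual_arr C T F F' x y \<alpha> \<alpha>'"
proof -
  have x: "x \<in> Hom C T X" and y: "y \<in> Hom C T X"
    and \<alpha>': "\<alpha>' \<in> Hom C T (slice C F' x)" "RFac F' x \<cdot> \<alpha>' = y"
    using assms by auto
  note fx = R.fac[OF x] and fy = L.fac[OF y]
  have "RFac F' x \<cdot> \<alpha>' = RFac F y \<cdot> LFac F y" using fy(5) \<alpha>'(2) by simp
  \<comment> \<open>Now the given point is \<open>(\<alpha>', e\<^sub>y)\<close> and the fibre is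
    the one over \<open>i\<^sub>x\<close>.\<close>
  from linked_ex1_right[OF fx(4) fy(2,4) fx(1,3) \<alpha>'(1) fy(3) this]
  show ?thesis using x y fx(5) by (simp add: dual_arr_def conj_ac)
qed

lemma dual_map_arrE:
  assumes "(y, \<alpha>', x) \<in> Arr (underlying_cat C T F' X)"
  obtains \<alpha> where "FArr (dual_map C T F F' X) (y, \<alpha>', x) = (x, \<alpha>, y)"
    "(x, \<alpha>, y) \<in> Arr (underlying_cat C T F X)" "dual_arr C T F F' x y \<alpha> \<alpha>'"
  using theI'[OF dual_arr_ex1_left[OF assms]] by (simp add: dual_map_def del: L.underlying_Arr)

lemma dual_map_arr_eq:
  assumes "(y, \<alpha>', x) \<in> Arr (underlying_cat C T F' X)"
    and "(x, \<alpha>, y) \<in> Arr (underlying_cat C T F X)" "dual_arr C T F F' x y \<alpha> \<alpha>'"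
  shows "FArr (dual_map C T F F' X) (y, \<alpha>', x) = (x, \<alpha>, y)"
  using the1_equality[OF dual_arr_ex1_left[OF assms(1)]] assms(2,3)
  by (simp add: dual_map_def del: L.underlying_Arr)

text \<open>Both components of \<open>(i\<^sub>x, e\<^sub>x)\<close> lie over \<open>x\<close>, so
  the pair is a point of \<open>[x, x]\<close>, connected to itself.\<close>

lemma dual_arr_ide:
  assumes x: "x \<in> Hom C T X"
  shows "dual_arr C T F F' x x (LFac F x) (LFac F' x)"
proof -
  note fx = R.fac[OF x] and gx = L.fac[OF x]
  obtain p q where pq: "chosen_pullback C (RFac F' x) (RFac F x) = (p, q)"
    "is_pullback C p q (RFac F' x) (RFac F x)"
    using chosen_pullback[OF fx(4) gx(4)] by blast
  obtain w where w: "w \<in> Hom C T (Dom C p)" "p \<cdot> w = LFac F' x" "q \<cdot> w = LFac F x"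
    using pullback_lift[OF pq(2), of "LFac F' x" T "LFac F x"] fx(3,5) gx(3,5)
      homD(2)[OF fx(4)] homD(2)[OF gx(4)] by metis
  show ?thesis
    using linked_iff[OF pq w(1) w(1)] w(2,3) connected_refl unfolding dual_arr_def by metis
qed

text \<open>\<open>(i\<^sub>x, \<beta>\<alpha>) \<sim> (\<alpha>', \<beta>) \<sim> (\<alpha>'\<beta>', e\<^sub>z)\<close>: the first step is the
  image of \<open>(i\<^sub>x, \<alpha>) \<sim> (\<alpha>', e\<^sub>y)\<close> and the second that of \<open>(i\<^sub>y, \<beta>) \<sim> (\<beta>', e\<^sub>z)\<close>.\<close>

lemma dual_arr_comp:
  assumes a: "(x, \<alpha>, y) \<in> Arr (underlying_cat C T F X)"
    and b: "(y, \<beta>, z) \<in> Arr (underlying_cat C T F X)"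
    and a': "(y, \<alpha>', x) \<in> Arr (underlying_cat C T F' X)"
    and b': "(z, \<beta>', y) \<in> Arr (underlying_cat C T F' X)"
    and da: "dual_arr C T F F' x y \<alpha> \<alpha>'" and db: "dual_arr C T F F' y z \<beta> \<beta>'"
  shows "dual_arr C T F F' x z (hat C F y \<beta> z \<cdot> \<alpha>) (hat C F' y \<alpha>' x \<cdot> \<beta>')"
proof -
  have x: "x \<in> Hom C T X" and y: "y \<in> Hom C T X" and z: "z \<in> Hom C T X"
    using a b by auto
  have X: "Ide C X \<in> Hom C X X" using ide_hom[OF homD(5)[OF x]] .
  note fx = R.fac[OF x] and fy = R.fac[OF y] and gy = L.fac[OF y] and gz = L.fac[OF z]
  have hb: "hat C F y \<beta> z \<in> Hom C (slice C F y) (slice C F z)"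
    "RFac F z \<cdot> hat C F y \<beta> z = RFac F y" "hat C F y \<beta> z \<cdot> LFac F y = \<beta>"
    using L.hat[OF y z] b by auto
  have ha: "hat C F' y \<alpha>' x \<in> Hom C (slice C F' y) (slice C F' x)"
    "RFac F' x \<cdot> hat C F' y \<alpha>' x = RFac F' y" "hat C F' y \<alpha>' x \<cdot> LFac F' y = \<alpha>'"
    using R.hat[OF y x] a' by auto
  have ix: "Ide C (slice C F' x) \<in> Hom C (slice C F' x) (slice C F' x)"
    and iz: "Ide C (slice C F z) \<in> Hom C (slice C F z) (slice C F z)"
    using ide_hom homD(5)[OF fx(3)] homD(5)[OF gz(3)] by auto
  \<comment> \<open>The map from \<open>[x, y]\<close> to \<open>[x, z]\<close> induced by the hat
    of \<open>\<beta>\<close>, which lies over \<open>X\<close>.\<close>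
  have 1: "linked C T F (RFac F' x) (RFac F z)
      (Ide C (slice C F' x) \<cdot> LFac F' x, hat C F y \<beta> z \<cdot> \<alpha>)
      (Ide C (slice C F' x) \<cdot> \<alpha>', hat C F y \<beta> z \<cdot> LFac F y)"
    by (rule linked_map[OF fx(4) gy(4) fx(4) gz(4) ix hb(1) X])
      (use comp_ide[OF fx(4)] comp_ide[OF gy(4)] hb(2) da in \<open>simp_all add: dual_arr_def\<close>)
  \<comment> \<open>The map from \<open>[y, z]\<close> to \<open>[x, z]\<close> induced by the hat
    of \<open>\<alpha>'\<close>.\<close>
  have 2: "linked C T F (RFac F' x) (RFac F z)
      (hat C F' y \<alpha>' x \<cdot> LFac F' y, Ide C (slice C F z) \<cdot> \<beta>)
      (hat C F' y \<alpha>' x \<cdot> \<beta>', Ide C (slice C F z) \<cdot> LFac F z)"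
    by (rule linked_map[OF fy(4) gz(4) fx(4) gz(4) ha(1) iz X])
      (use comp_ide[OF fy(4)] comp_ide[OF gz(4)] ha(2) db in \<open>simp_all add: dual_arr_def\<close>)
  have "\<alpha>' \<in> Hom C T (slice C F' x)" "\<beta> \<in> Hom C T (slice C F z)" using a' b by auto
  then show ?thesis
    using linked_trans[OF fx(4) gz(4)] 1 2 ha(3) hb(3) comp_ide[OF fx(3)] comp_ide[OF gz(3)] comp_ide(2)
    unfolding dual_arr_def by metis
qed

text \<open>The slice maps of \<open>f\<close> induce a map from \<open>[x, y]\<close> to the
  pullback for \<open>f \<cdot> x\<close> and \<open>f \<cdot> y\<close>. They take
  \<open>i\<^sub>x\<close> and \<open>e\<^sub>y\<close> to the left factors at the image points, so
  the linked pairs keep their form.\<close>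

lemma dual_arr_map:
  assumes x: "x \<in> Hom C T X" and y: "y \<in> Hom C T X" and f: "f \<in> Hom C X Y"
    and d: "dual_arr C T F F' x y \<alpha> \<alpha>'"
  shows "dual_arr C T F F' (f \<cdot> x) (f \<cdot> y) (slice_map C F f y \<cdot> \<alpha>) (slice_map C F' f x \<cdot> \<alpha>')"
proof -
  note sx = R.slice_map[OF x f] and sy = L.slice_map[OF y f]
  show ?thesis
    using linked_map[OF R.fac(4)[OF x] L.fac(4)[OF y] R.fac(4)[OF comp_hom[OF x f]]
      L.fac(4)[OF comp_hom[OF y f]] sx(1) sy(1) f sx(2) sy(2) d[unfolded dual_arr_def]] sx(3) sy(3)
    unfolding dual_arr_def by simp
qed

section \<open>The natural isomorphism\<close>

lemma is_functor_dual_map: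
  "is_functor (underlying_cat C T F' X) (op_cat (underlying_cat C T F X)) (dual_map C T F F' X)"
  unfolding is_functor_def
proof (intro conjI ballI allI)
  fix a assume "a \<in> Arr (underlying_cat C T F' X)"
  then obtain y \<alpha>' x where a: "a = (y, \<alpha>', x)" "(y, \<alpha>', x) \<in> Arr (underlying_cat C T F' X)"
    by (cases a) auto
  show "FArr (dual_map C T F F' X) a \<in> Hom (op_cat (underlying_cat C T F X))
      (FObj (dual_map C T F F' X) (Dom (underlying_cat C T F' X) a))
      (FObj (dual_map C T F F' X) (Cod (underlying_cat C T F' X) a))"
    by (rule dual_map_arrE[OF a(2)]) (simp add: a(1) L.underlying_Hom_iff, simp add: dual_map_def)
next
  fix x assume "x \<in> Obj (underlying_cat C T F' X)"
  then have x: "x \<in> Hom C T X" by simp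
  show "FArr (dual_map C T F F' X) (Ide (underlying_cat C T F' X) x) =
      Ide (op_cat (underlying_cat C T F X)) (FObj (dual_map C T F F' X) x)"
    using dual_map_arr_eq[OF _ _ dual_arr_ide[OF x], of X] x R.fac[OF x] L.fac[OF x]
    by simp (simp add: dual_map_def)
next
  fix z y x b a
  assume "b \<in> Hom (underlying_cat C T F' X) z y" "a \<in> Hom (underlying_cat C T F' X) y x"
  then obtain \<alpha>' \<beta>' where a: "a = (y, \<alpha>', x)" and a': "(y, \<alpha>', x) \<in> Arr (underlying_cat C T F' X)"
    and b: "b = (z, \<beta>', y)" and b': "(z, \<beta>', y) \<in> Arr (underlying_cat C T F' X)"
    unfolding R.underlying_Hom_iff by blast
  obtain \<alpha> where \<alpha>: "FArr (dual_map C T F F' X) a = (x, \<alpha>, y)"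
    "(x, \<alpha>, y) \<in> Arr (underlying_cat C T F X)" "dual_arr C T F F' x y \<alpha> \<alpha>'"
    using dual_map_arrE[OF a'] unfolding a by blast
  obtain \<beta> where \<beta>: "FArr (dual_map C T F F' X) b = (y, \<beta>, z)"
    "(y, \<beta>, z) \<in> Arr (underlying_cat C T F X)" "dual_arr C T F F' y z \<beta> \<beta>'"
    using dual_map_arrE[OF b'] unfolding b by blast
  \<comment> \<open>On the right \<open>a\<close> follows \<open>b\<close>, whereas on the left the
    image of \<open>b\<close> follows that of \<open>a\<close>; \<open>dual_arr_comp\<close> relates
    exactly these composites.\<close>
  have "FArr (dual_map C T F F' X) (z, hat C F' y \<alpha>' x \<cdot> \<beta>', x) = (x, hat C F y \<beta> z \<cdot> \<alpha>, z)"
  proof (rule dual_map_arr_eq[OF _ _ dual_arr_comp[OF \<alpha>(2) \<beta>(2) a' b' \<alpha>(3) \<beta>(3)]])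
    show "(z, hat C F' y \<alpha>' x \<cdot> \<beta>', x) \<in> Arr (underlying_cat C T F' X)"
      using R.hat_comp(1,2)[OF b' a'] a' b' by simp
    show "(x, hat C F y \<beta> z \<cdot> \<alpha>, z) \<in> Arr (underlying_cat C T F X)"
      using L.hat_comp(1,2)[OF \<alpha>(2) \<beta>(2)] \<alpha>(2) \<beta>(2) by simp
  qed
  then show "FArr (dual_map C T F F' X) (a \<cdot>\<^bsub>underlying_cat C T F' X\<^esub> b) =
      FArr (dual_map C T F F' X) a \<cdot>\<^bsub>op_cat (underlying_cat C T F X)\<^esub> FArr (dual_map C T F F' X) b"
    unfolding \<alpha>(1) \<beta>(1) by (simp add: a b)
qed (simp_all add: R.is_category_underlying_cat L.is_category_underlying_cat is_category_op_cat
    dual_map_def)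

text \<open>The endpoints can be read off the triples. Between fixed endpoints,
  \<open>dual_arr_ex1_right\<close> gives injectivity by its uniqueness and surjectivity by its
  existence.\<close>

lemma bij_betw_dual_map:
  "bij_betw (FArr (dual_map C T F F' X)) (Arr (underlying_cat C T F' X))
     (Arr (underlying_cat C T F X))"
proof (rule bij_betw_imageI)
  show "inj_on (FArr (dual_map C T F F' X)) (Arr (underlying_cat C T F' X))"
  proof (rule inj_onI)
    fix a b assume a: "a \<in> Arr (underlying_cat C T F' X)" and b: "b \<in> Arr (underlying_cat C T F' X)"
      and eq: "FArr (dual_map C T F F' X) a = FArr (dual_map C T F F' X) b"
    obtain y \<alpha>' x y2 \<beta>' x2 where ab: "a = (y, \<alpha>', x)" "b = (y2, \<beta>', x2)"
      by (cases a; cases b) auto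
    obtain \<alpha> where \<alpha>: "FArr (dual_map C T F F' X) a = (x, \<alpha>, y)"
      "(x, \<alpha>, y) \<in> Arr (underlying_cat C T F X)" "dual_arr C T F F' x y \<alpha> \<alpha>'"
      using dual_map_arrE a unfolding ab by blast
    obtain \<beta> where \<beta>: "FArr (dual_map C T F F' X) b = (x2, \<beta>, y2)" "dual_arr C T F F' x2 y2 \<beta> \<beta>'"
      using dual_map_arrE b unfolding ab by blast
    have "x2 = x" "y2 = y" "\<beta> = \<alpha>" using eq \<alpha>(1) \<beta>(1) by simp_all
    then show "a = b" using dual_arr_ex1_right[OF \<alpha>(2)] \<alpha>(3) \<beta>(2) a b unfolding ab by blast
  qed
  show "FArr (dual_map C T F F' X) ` Arr (underlying_cat C T F' X) = Arr (underlying_cat C T F X)"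
  proof (intro equalityI subsetI)
    fix c assume "c \<in> FArr (dual_map C T F F' X) ` Arr (underlying_cat C T F' X)"
    then obtain y \<alpha>' x where "(y, \<alpha>', x) \<in> Arr (underlying_cat C T F' X)"
      "c = FArr (dual_map C T F F' X) (y, \<alpha>', x)"
      by auto
    then show "c \<in> Arr (underlying_cat C T F X)" using dual_map_arrE by metis
  next
    fix c assume c: "c \<in> Arr (underlying_cat C T F X)"
    obtain x \<alpha> y where xy: "c = (x, \<alpha>, y)" by (cases c) auto
    obtain \<alpha>' where "(y, \<alpha>', x) \<in> Arr (underlying_cat C T F' X)" "dual_arr C T F F' x y \<alpha> \<alpha>'"
      using dual_arr_ex1_right c unfolding xy by blast
    then show "c \<in> FArr (dual_map C T F F' X) ` Arr (underlying_cat C T F' X)"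
      using dual_map_arr_eq c unfolding xy by (metis imageI)
  qed
qed

text \<open>By \<open>dual_arr_map\<close> the images of related arrows are related, and the
  relation determines the value of \<open>dual_map\<close> at \<open>Y\<close>.\<close>

lemma dual_map_natural:
  assumes f: "f \<in> Hom C X Y" and a: "(y, \<alpha>', x) \<in> Arr (underlying_cat C T F' X)"
  shows "FArr (underlying_map C F f) (FArr (dual_map C T F F' X) (y, \<alpha>', x)) =
    FArr (dual_map C T F F' Y) (FArr (underlying_map C F' f) (y, \<alpha>', x))"
proof -
  have x: "x \<in> Hom C T X" and y: "y \<in> Hom C T X" using a by auto
  obtain \<alpha> where \<alpha>: "FArr (dual_map C T F F' X) (y, \<alpha>', x) = (x, \<alpha>, y)"
    "(x, \<alpha>, y) \<in> Arr (underlying_cat C T F X)" "dual_arr C T F F' x y \<alpha> \<alpha>'"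
    using dual_map_arrE[OF a] by blast
  have "FArr (dual_map C T F F' Y) (f \<cdot> y, slice_map C F' f x \<cdot> \<alpha>', f \<cdot> x) =
      (f \<cdot> x, slice_map C F f y \<cdot> \<alpha>, f \<cdot> y)"
    by (rule dual_map_arr_eq[OF _ _ dual_arr_map[OF x y f \<alpha>(3)]])
      (use is_functorD(5)[OF R.is_functor_underlying_map[OF f] a]
        is_functorD(5)[OF L.is_functor_underlying_map[OF f] \<alpha>(2)]
        in \<open>simp_all add: underlying_map_def\<close>)
  then show ?thesis by (simp add: \<alpha>(1)) (simp add: underlying_map_def)
qed

lemma is_nat_iso_dual_map:
  "is_nat_iso C Cat (underlying_functor C T F') (comp_func op_functor (underlying_functor C T F))
     (\<lambda>X. (underlying_cat C T F' X,
       restrict_func (underlying_cat C T F' X) (dual_map C T F F' X),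
       op_cat (underlying_cat C T F X)))"
  (is "is_nat_iso C Cat _ ?G ?\<eta>")
  unfolding is_nat_iso_def
proof (intro conjI ballI)
  show "is_functor C Cat (underlying_functor C T F')"
    by (rule R.is_functor_underlying_functor)
  show "is_functor C Cat ?G"
    by (rule is_functor_comp[OF L.is_functor_underlying_functor is_functor_op_functor])
  have G: "FObj ?G X = op_cat (underlying_cat C T F X)" for X
    by (simp add: L.underlying_functor_simps op_functor_def)
  show "?\<eta> X \<in> Hom Cat (FObj (underlying_functor C T F') X) (FObj ?G X)" for X
    unfolding G R.underlying_functor_simps(1) by (rule Cat_HomI[OF is_functor_dual_map])
  \<comment> \<open>On objects the component is the identity on the points of \<open>X\<close>; on
    arrows it is the bijection just established.\<close>
  show "is_iso Cat (?\<eta> X)" for X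
    by (rule is_iso_CatI[OF is_functor_dual_map])
      (simp_all add: bij_betw_dual_map, simp add: dual_map_def bij_betw_def)
next
  fix f assume "f \<in> Arr C"
  then have f: "f \<in> Hom C (Dom C f) (Cod C f)" by (rule arr_hom)
  show "FArr ?G f \<cdot>\<^bsub>Cat\<^esub> ?\<eta> (Dom C f) = ?\<eta> (Cod C f) \<cdot>\<^bsub>Cat\<^esub> FArr (underlying_functor C T F') f"
    unfolding comp_func_apply L.underlying_functor_simps(2)[OF f] op_functor_restrict
      R.underlying_functor_simps(2)[OF f] Cat_comp_restrict[OF is_functor_dual_map]
      Cat_comp_restrict[OF R.is_functor_underlying_map[OF f]]
    using dual_map_natural[OF f]
    by (auto intro!: restrict_func_cong simp del: R.underlying_Arr)
      (simp add: dual_map_def underlying_map_def)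
qed

end

theorem corollary4p15:
  fixes C :: "('o, 'a) cat" and T :: 'o and F F' :: "'a fact_sys"
  assumes "balanced_factorization_category C T F F'"
  shows "naturally_isomorphic C Cat
           (underlying_functor C T F')
           (comp_func op_functor (underlying_functor C T F))"
proof -
  interpret balanced C T F F'
    using assms by unfold_locales (simp add: balanced_factorization_category_def)
  show ?thesis unfolding naturally_isomorphic_def using is_nat_iso_dual_map by blast
qed

end
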